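(* Let $\Gamma$ be a finitely generated discrete group with the right-invariant word metric $d$. If the inclusion $C^*_r(\Gamma)\subseteq UC^*(\Gamma)$ (given by the left regular representation) is a nuclear map, then $\Gamma$, as the metric space $(\Gamma,d)$, is uniformly embeddable in a Hilbert space.
   Context: Fix a finite symmetric generating set of $\Gamma$ with word length $l$, and let $d(s,t)=l(st^{-1})$. The left regular representation $\lambda$ of $\Gamma$ on $\ell^2(\Gamma)$ is $\lambda_t\delta_r=\delta_{tr}$, where $\delta_r$ is the indicator of $r$; $C^*_r(\Gamma)$ is the norm closure of the span of $\{\lambda_t\}$ in $\mathcal{B}(\ell^2(\Gamma))$. A finite width operator is a function $A:\Gamma\times\Gamma\to\mathbb{C}$ that is bounded and for which there is $R>0$ with $A(s,t)=0$ whenever $d(s,t)>R$; it acts on $\ell^2(\Gamma)$ by $(A\xi)(s)=\sum_r A(s,r)\xi(r)$. The uniform Roe algebra $UC^*(\Gamma)$ is the norm closure in $\mathcal{B}(\ell^2(\Gamma))$ of the $*$-algebra of finite width operators; it contains $C^*_r(\Gamma)$. The inclusion $C^*_r(\Gamma)\to UC^*(\Gamma)$ is nuclear if there is a net $T_\lambda:C^*_r(\Gamma)\to UC^*(\Gamma)$ of finite rank, unital, completely positive linear maps with $\|T_\lambda(x)-x\|\to0$ for all $x\in C^*_r(\Gamma)$. A map $f$ from a metric space $(X,d)$ to a separable Hilbert space is a uniform embedding if there exist non-decreasing proper functions $\rho_\pm:[0,\infty)\to[0,\infty)$ with $\rho_-(d(x,y))\le\|f(x)-f(y)\|\le\rho_+(d(x,y))$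 for all $x,y$. *)

theory Defs
  imports "HOL-Algebra.Generated_Groups" "HOL-Analysis.Analysis"
begin

type_synonym 'a kernel = "'a \<Rightarrow> 'a \<Rightarrow> complex"

definition word_length :: "('a, 'b) monoid_scheme \<Rightarrow> 'a set \<Rightarrow> 'a \<Rightarrow> nat" where
  "word_length G S g =
     (LEAST n. \<exists>xs. length xs = n \<and> set xs \<subseteq> S \<and> foldr (\<otimes>\<^bsub>G\<^esub>) xs \<one>\<^bsub>G\<^esub> = g)"

definition word_dist :: "('a, 'b) monoid_scheme \<Rightarrow> 'a set \<Rightarrow> 'a \<Rightarrow> 'a \<Rightarrow> nat" where
  "word_dist G S s t = word_length G S (s \<otimes>\<^bsub>G\<^esub> inv\<^bsub>G\<^esub> t)"

definition l2 :: "('a, 'b) monoid_scheme \<Rightarrow> ('a \<Rightarrow> complex) set" where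
  "l2 G = {\<xi>. (\<forall>x. x \<notin> carrier G \<longrightarrow> \<xi> x = 0) \<and>
              (\<lambda>x. (cmod (\<xi> x))\<^sup>2) summable_on carrier G}"

definition l2norm :: "('a, 'b) monoid_scheme \<Rightarrow> ('a \<Rightarrow> complex) \<Rightarrow> real" where
  "l2norm G \<xi> = sqrt (\<Sum>\<^sub>\<infinity>x\<in>carrier G. (cmod (\<xi> x))\<^sup>2)"

definition l2inner :: "('a, 'b) monoid_scheme \<Rightarrow> ('a \<Rightarrow> complex) \<Rightarrow> ('a \<Rightarrow> complex) \<Rightarrow> complex" where
  "l2inner G \<xi> \<eta> = (\<Sum>\<^sub>\<infinity>x\<in>carrier G. \<xi> x * cnj (\<eta> x))"

definition kapply :: "('a, 'b) monoid_scheme \<Rightarrow> 'a kernel \<Rightarrow> ('a \<Rightarrow> complex) \<Rightarrow> ('a \<Rightarrow> complex)" where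
  "kapply G A \<xi> = (\<lambda>s. if s \<in> carrier G then (\<Sum>\<^sub>\<infinity>r\<in>carrier G. A s r * \<xi> r) else 0)"

text \<open>A matrix (supported on Gamma x Gamma) defines a bounded operator on l2(Gamma).
  Every bounded operator on l2(Gamma) arises this way from a unique such matrix.\<close>
definition bounded_op :: "('a, 'b) monoid_scheme \<Rightarrow> 'a kernel \<Rightarrow> bool" where
  "bounded_op G A \<longleftrightarrow>
     (\<forall>s r. (s \<notin> carrier G \<or> r \<notin> carrier G) \<longrightarrow> A s r = 0) \<and>
     (\<forall>s\<in>carrier G. A s \<in> l2 G) \<and>
     (\<exists>C. \<forall>\<xi>\<in>l2 G. kapply G A \<xi> \<in> l2 G \<and> l2norm G (kapply G A \<xi>) \<le> C * l2norm G \<xi>)"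

definition opnorm :: "('a, 'b) monoid_scheme \<Rightarrow> 'a kernel \<Rightarrow> real" where
  "opnorm G A = (SUP \<xi>\<in>{\<xi>\<in>l2 G. l2norm G \<xi> \<le> 1}. l2norm G (kapply G A \<xi>))"

definition kdiff :: "'a kernel \<Rightarrow> 'a kernel \<Rightarrow> 'a kernel" where
  "kdiff A B = (\<lambda>s r. A s r - B s r)"

definition lreg :: "('a, 'b) monoid_scheme \<Rightarrow> 'a \<Rightarrow> 'a kernel" where
  "lreg G t = (\<lambda>s r. if s \<in> carrier G \<and> r \<in> carrier G \<and> s = t \<otimes>\<^bsub>G\<^esub> r then 1 else 0)"

definition reduced_cstar :: "('a, 'b) monoid_scheme \<Rightarrow> 'a kernel set" where
  "reduced_cstar G = {x. bounded_op G x \<and>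
     (\<forall>\<epsilon>>0. \<exists>F c. finite F \<and> F \<subseteq> carrier G \<and>
        opnorm G (kdiff x (\<lambda>s r. \<Sum>t\<in>F. c t * lreg G t s r)) < \<epsilon>)}"

definition finite_width :: "('a, 'b) monoid_scheme \<Rightarrow> 'a set \<Rightarrow> 'a kernel \<Rightarrow> bool" where
  "finite_width G S A \<longleftrightarrow>
     (\<forall>s r. (s \<notin> carrier G \<or> r \<notin> carrier G) \<longrightarrow> A s r = 0) \<and>
     (\<exists>M. \<forall>s r. cmod (A s r) \<le> M) \<and>
     (\<exists>R>0. \<forall>s\<in>carrier G. \<forall>t\<in>carrier G. real (word_dist G S s t) > R \<longrightarrow> A s t = 0)"

definition uniform_roe :: "('a, 'b) monoid_scheme \<Rightarrow> 'a set \<Rightarrow> 'a kernel set" where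
  "uniform_roe G S = {x. bounded_op G x \<and>
     (\<forall>\<epsilon>>0. \<exists>y. finite_width G S y \<and> bounded_op G y \<and> opnorm G (kdiff x y) < \<epsilon>)}"

text \<open>An n x n matrix of operators is positive iff it is a positive operator on (l2)^n.\<close>
definition pos_opmatrix :: "('a, 'b) monoid_scheme \<Rightarrow> nat \<Rightarrow> (nat \<Rightarrow> nat \<Rightarrow> 'a kernel) \<Rightarrow> bool" where
  "pos_opmatrix G n X \<longleftrightarrow>
     (\<forall>\<eta>. (\<forall>i<n. \<eta> i \<in> l2 G) \<longrightarrow>
        (let z = (\<Sum>i<n. \<Sum>j<n. l2inner G (kapply G (X i j) (\<eta> j)) (\<eta> i)) in Im z = 0 \<and> Re z \<ge> 0))"

definition completely_positive_on ::
    "('a, 'b) monoid_scheme \<Rightarrow> 'a kernel set \<Rightarrow> ('a kernel \<Rightarrow> 'a kernel) \<Rightarrow> bool" where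
  "completely_positive_on G A T \<longleftrightarrow>
     (\<forall>n X. (\<forall>i<n. \<forall>j<n. X i j \<in> A) \<longrightarrow> pos_opmatrix G n X \<longrightarrow>
            pos_opmatrix G n (\<lambda>i j. T (X i j)))"

definition linear_on :: "'a kernel set \<Rightarrow> ('a kernel \<Rightarrow> 'a kernel) \<Rightarrow> bool" where
  "linear_on A T \<longleftrightarrow>
     (\<forall>x\<in>A. \<forall>y\<in>A. \<forall>a b::complex.
        T (\<lambda>s r. a * x s r + b * y s r) = (\<lambda>s r. a * T x s r + b * T y s r))"

definition finite_rank_on :: "'a kernel set \<Rightarrow> ('a kernel \<Rightarrow> 'a kernel) \<Rightarrow> bool" where
  "finite_rank_on A T \<longleftrightarrow>
     (\<exists>F. finite F \<and> (\<forall>x\<in>A. \<exists>c. T x = (\<lambda>s r. \<Sum>f\<in>F. c f * f s r)))"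

definition fr_ucp_map :: "('a, 'b) monoid_scheme \<Rightarrow> 'a set \<Rightarrow> ('a kernel \<Rightarrow> 'a kernel) \<Rightarrow> bool" where
  "fr_ucp_map G S T \<longleftrightarrow>
     (\<forall>x\<in>reduced_cstar G. T x \<in> uniform_roe G S) \<and>
     linear_on (reduced_cstar G) T \<and>
     finite_rank_on (reduced_cstar G) T \<and>
     T (lreg G \<one>\<^bsub>G\<^esub>) = lreg G \<one>\<^bsub>G\<^esub> \<and>
     completely_positive_on G (reduced_cstar G) T"

definition directed_order :: "('i \<Rightarrow> 'i \<Rightarrow> bool) \<Rightarrow> bool" where
  "directed_order leq \<longleftrightarrow> (\<forall>i. leq i i) \<and> (\<forall>i j k. leq i j \<longrightarrow> leq j k \<longrightarrow> leq i k) \<and>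
     (\<forall>i j. \<exists>k. leq i k \<and> leq j k)"

section \<open>Uniform embedding into a separable Hilbert space (realised as l2(N))\<close>

definition l2seq_dist :: "(nat \<Rightarrow> real) \<Rightarrow> (nat \<Rightarrow> real) \<Rightarrow> real" where
  "l2seq_dist u v = sqrt (\<Sum>n. (u n - v n)\<^sup>2)"

definition proper_control :: "(real \<Rightarrow> real) \<Rightarrow> bool" where
  "proper_control \<rho> \<longleftrightarrow> mono_on {0..} \<rho> \<and> (\<forall>t\<ge>0. \<rho> t \<ge> 0) \<and> filterlim \<rho> at_top at_top"

definition uniformly_embeddable :: "('a, 'b) monoid_scheme \<Rightarrow> 'a set \<Rightarrow> bool" where
  "uniformly_embeddable G S \<longleftrightarrow>
     (\<exists>f :: 'a \<Rightarrow> nat \<Rightarrow> real.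
        (\<forall>x\<in>carrier G. summable (\<lambda>n. (f x n)\<^sup>2)) \<and>
        (\<exists>\<rho>m \<rho>p. proper_control \<rho>m \<and> proper_control \<rho>p \<and>
           (\<forall>x\<in>carrier G. \<forall>y\<in>carrier G.
              \<rho>m (real (word_dist G S x y)) \<le> l2seq_dist (f x) (f y) \<and>
              l2seq_dist (f x) (f y) \<le> \<rho>p (real (word_dist G S x y)))))"

end

theory Submission
  imports Defs
begin

text \<open>A finite rank unital completely positive map \<open>T\<close> yields the kernel
  \<open>u(s,t) = Re \<langle>T(\<lambda>\<^sub>s \<lambda>\<^sub>t\<^sup>*) \<delta>\<^sub>t, \<delta>\<^sub>s\<rangle>\<close>, which is positive definite with \<open>u(s,s) = 1\<close>. It is close to 1
  on a strip \<open>d(s,t) \<le> n\<close> when \<open>T\<close> is close to the identity on the finitely many \<open>\<lambda>\<^sub>g\<close> with \<open>l(g) \<le> n\<close>.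
  It tends to 0 as \<open>d(s,t) \<rightarrow> \<infinity>\<close>: the elements \<open>T(\<lambda>\<^sub>g)\<close> form a bounded subset of a finite dimensional
  subspace of the Roe algebra, and the entries of an element of the Roe algebra decay off the diagonal.
  Choosing \<open>u\<^sub>n\<close> with \<open>\<bar>1 - u\<^sub>n(s,t)\<bar> \<le> 2\<^sup>-\<^sup>n\<close> for \<open>d(s,t) \<le> n\<close>, the function
  \<open>\<Sum>\<^sub>n 2 (1 - u\<^sub>n(s,t))\<close> is the squared distance of a map into a Hilbert space, bounded above in terms of
  \<open>d(s,t)\<close> and tending to infinity with \<open>d(s,t)\<close>.\<close>

section \<open>Positive definite kernels\<close>

text \<open>A quadratic form with real coefficients sees only the symmetric part of a matrix, so
  symmetry is a separate clause. The points \<open>g i\<close> may repeat, so a point can be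
  adjoined to a family without asking whether it is already there.\<close>

definition pd_kernel :: "'x set \<Rightarrow> ('x \<Rightarrow> 'x \<Rightarrow> real) \<Rightarrow> bool" where
  "pd_kernel X K \<longleftrightarrow> (\<forall>x\<in>X. \<forall>y\<in>X. K x y = K y x) \<and>
     (\<forall>n (g :: nat \<Rightarrow> 'x) c. (\<forall>i<n. g i \<in> X) \<longrightarrow> 0 \<le> (\<Sum>i<n. \<Sum>j<n. c i * c j * K (g i) (g j)))"

lemma pd_kernel_sym: "pd_kernel X K \<Longrightarrow> x \<in> X \<Longrightarrow> y \<in> X \<Longrightarrow> K x y = K y x"
  by (simp add: pd_kernel_def)

lemma pd_kernel_nonneg:
  "pd_kernel X K \<Longrightarrow> (\<And>i. i < n \<Longrightarrow> g i \<in> X) \<Longrightarrow> 0 \<le> (\<Sum>i<n. \<Sum>j<n. c i * c j * K (g i) (g j))"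
  for g :: "nat \<Rightarrow> 'x"
  by (simp add: pd_kernel_def)

text \<open>This is positivity for the family \<open>g\<close> enlarged by \<open>x\<close> with
  coefficient \<open>t\<close>, expanded as a quadratic polynomial in \<open>t\<close>. The lemmas
  below differ only in the choice of \<open>t\<close>.\<close>

lemma pd_kernel_shift:
  fixes g :: "nat \<Rightarrow> 'x"
  assumes K: "pd_kernel X K" and g: "\<And>i. i < n \<Longrightarrow> g i \<in> X" and x: "x \<in> X"
  shows "0 \<le> (\<Sum>i<n. \<Sum>j<n. c i * c j * K (g i) (g j)) + 2 * t * (\<Sum>i<n. c i * K (g i) x) + t\<^sup>2 * K x x"
proof -
  let ?g = "g(n := x)" and ?c = "c(n := t)"
  have "0 \<le> (\<Sum>i<Suc n. \<Sum>j<Suc n. ?c i * ?c j * K (?g i) (?g j))"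
    by (rule pd_kernel_nonneg[OF K]) (use g x in \<open>auto simp: less_Suc_eq\<close>)
  also have "\<dots> = (\<Sum>i<n. (\<Sum>j<n. c i * c j * K (g i) (g j)) + c i * t * K (g i) x)
      + ((\<Sum>j<n. t * c j * K x (g j)) + t * t * K x x)"
    by simp
  also have "(\<Sum>j<n. t * c j * K x (g j)) = t * (\<Sum>i<n. c i * K (g i) x)"
    by (simp add: sum_distrib_left mult.assoc pd_kernel_sym[OF K x g])
  also have "(\<Sum>i<n. (\<Sum>j<n. c i * c j * K (g i) (g j)) + c i * t * K (g i) x)
     = (\<Sum>i<n. \<Sum>j<n. c i * c j * K (g i) (g j)) + t * (\<Sum>i<n. c i * K (g i) x)"
    by (simp add: sum.distrib sum_distrib_left mult_ac)
  finally show ?thesis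
    by (simp add: power2_eq_square algebra_simps)
qed

lemma pd_kernel_shift2:
  assumes "pd_kernel X K" "x \<in> X" "y \<in> X"
  shows "0 \<le> K y y + 2 * t * K y x + t\<^sup>2 * K x x"
  using pd_kernel_shift[of X K 1 "\<lambda>_. y" x "\<lambda>_. 1" t] assms by simp

lemma pd_kernel_diag_nonneg: "pd_kernel X K \<Longrightarrow> x \<in> X \<Longrightarrow> 0 \<le> K x x"
  using pd_kernel_shift2[of X K x x 0] by simp

lemma pd_kernel_diag_zero:
  assumes "pd_kernel X K" "x \<in> X" "y \<in> X" "K x x = 0"
  shows "K y x = 0"
proof (rule ccontr)
  assume "K y x \<noteq> 0"
  \<comment> \<open>With a zero pivot the polynomial in \<open>t\<close> is affine; this
    \<open>t\<close> is chosen to give it the value -1.\<close>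
  then show False
    using pd_kernel_shift2[OF assms(1-3), of "- (K y y + 1) / (2 * K y x)"] assms(4)
    by (simp add: field_simps)
qed

lemma pd_kernel_abs_le_1:
  assumes "pd_kernel X K" "x \<in> X" "y \<in> X" "K x x = 1" "K y y = 1"
  shows "\<bar>K x y\<bar> \<le> 1"
  using pd_kernel_shift2[of X K y x 1] pd_kernel_shift2[of X K y x "-1"] assms by simp

text \<open>The polynomial of \<open>pd_kernel_shift\<close> is evaluated at its minimiser
  \<open>t = - b / K x x\<close>; the minimum is the form of the Schur complement.\<close>

lemma pd_kernel_schur:
  assumes K: "pd_kernel X K" and x: "x \<in> X"
  shows "pd_kernel X (\<lambda>y z. K y z - K y x * K z x / K x x)"
  unfolding pd_kernel_def
proof (intro conjI ballI allI impI)
  fix y z assume "y \<in> X" "z \<in> X"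
  then show "K y z - K y x * K z x / K x x = K z y - K z x * K y x / K x x"
    using pd_kernel_sym[OF K] by (simp add: mult.commute)
next
  fix n and g :: "nat \<Rightarrow> 'a" and c :: "nat \<Rightarrow> real"
  assume g: "\<forall>i<n. g i \<in> X"
  define b where "b = (\<Sum>i<n. c i * K (g i) x)"
  have sq: "b * b = (\<Sum>i<n. \<Sum>j<n. c i * c j * (K (g i) x * K (g j) x))"
    unfolding b_def sum_product by (simp add: mult_ac)
  have "(\<Sum>i<n. \<Sum>j<n. c i * c j * (K (g i) (g j) - K (g i) x * K (g j) x / K x x))
     = (\<Sum>i<n. \<Sum>j<n. c i * c j * K (g i) (g j)) - b * b / K x x"
    unfolding sq sum_divide_distrib by (simp add: algebra_simps sum_subtractf)
  \<comment> \<open>If \<open>K x x = 0\<close>, every quotient is 0 by convention and both sides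
    reduce to the form of \<open>K\<close>.\<close>
  also have "\<dots> = (\<Sum>i<n. \<Sum>j<n. c i * c j * K (g i) (g j)) + 2 * (- b / K x x) * b + (- b / K x x)\<^sup>2 * K x x"
    by (cases "K x x = 0") (simp_all add: field_simps power2_eq_square)
  also have "\<dots> \<ge> 0"
    unfolding b_def by (rule pd_kernel_shift[OF K _ x]) (use g in auto)
  finally show "0 \<le> (\<Sum>i<n. \<Sum>j<n. c i * c j * (K (g i) (g j) - K (g i) x * K (g j) x / K x x))" .
qed

text \<open>If \<open>K\<close> is the Gram kernel of vectors v(x), this is the Gram kernel of v(x)
  - v(e). In the form of \<open>K\<close> it amounts to adjoining \<open>e\<close> with the
  coefficient \<open>- s\<close> that makes the coefficients sum to zero.\<close>

lemma pd_kernel_center: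
  assumes K: "pd_kernel X K" and e: "e \<in> X"
  shows "pd_kernel X (\<lambda>x y. K x y - K x e - K y e + K e e)"
  unfolding pd_kernel_def
proof (intro conjI ballI allI impI)
  fix y z assume "y \<in> X" "z \<in> X"
  then show "K y z - K y e - K z e + K e e = K z y - K z e - K y e + K e e"
    using pd_kernel_sym[OF K] by simp
next
  fix n and g :: "nat \<Rightarrow> 'a" and c :: "nat \<Rightarrow> real"
  assume g: "\<forall>i<n. g i \<in> X"
  define b where "b = (\<Sum>i<n. c i * K (g i) e)"
  define s where "s = (\<Sum>i<n. c i)"
  have sq: "s * s = (\<Sum>i<n. \<Sum>j<n. c i * c j)"
    unfolding s_def sum_product ..
  have sb: "s * b = (\<Sum>i<n. \<Sum>j<n. c i * c j * K (g j) e)"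
    unfolding s_def b_def sum_product by (simp add: mult_ac)
  have bs: "b * s = (\<Sum>i<n. \<Sum>j<n. c i * c j * K (g i) e)"
    unfolding s_def b_def sum_product by (simp add: mult_ac)
  have "(\<Sum>i<n. \<Sum>j<n. c i * c j * (K (g i) (g j) - K (g i) e - K (g j) e + K e e))
     = (\<Sum>i<n. \<Sum>j<n. c i * c j * K (g i) (g j)) - b * s - s * b + s * s * K e e"
    unfolding sq sb bs sum_distrib_right by (simp add: algebra_simps sum_subtractf sum.distrib)
  also have "\<dots> = (\<Sum>i<n. \<Sum>j<n. c i * c j * K (g i) (g j)) + 2 * (- s) * b + (- s)\<^sup>2 * K e e"
    by (simp add: power2_eq_square)
  also have "\<dots> \<ge> 0"
    unfolding b_def by (rule pd_kernel_shift[OF K _ e]) (use g in auto)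
  finally show "0 \<le> (\<Sum>i<n. \<Sum>j<n. c i * c j * (K (g i) (g j) - K (g i) e - K (g j) e + K e e))" .
qed

lemma pd_kernel_suminf:
  assumes K: "\<And>n :: nat. pd_kernel X (K n)"
    and summ: "\<And>x y. x \<in> X \<Longrightarrow> y \<in> X \<Longrightarrow> summable (\<lambda>n. K n x y)"
  shows "pd_kernel X (\<lambda>x y. \<Sum>n. K n x y)"
  unfolding pd_kernel_def
proof (intro conjI ballI allI impI)
  fix y z assume "y \<in> X" "z \<in> X"
  then show "(\<Sum>n. K n y z) = (\<Sum>n. K n z y)"
    using pd_kernel_sym[OF K] by simp
next
  fix n and g :: "nat \<Rightarrow> 'a" and c :: "nat \<Rightarrow> real"
  assume g: "\<forall>i<n. g i \<in> X"
  have s: "(\<lambda>k. \<Sum>i<n. \<Sum>j<n. c i * c j * K k (g i) (g j)) sums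
     (\<Sum>i<n. \<Sum>j<n. c i * c j * (\<Sum>k. K k (g i) (g j)))"
    using g by (intro sums_sum sums_mult summable_sums summ) auto
  show "0 \<le> (\<Sum>i<n. \<Sum>j<n. c i * c j * (\<Sum>k. K k (g i) (g j)))"
    by (rule sums_le[OF _ sums_zero s]) (use g in \<open>auto intro!: pd_kernel_nonneg[OF K]\<close>)
qed

text \<open>Cholesky factorisation: \<open>Q n\<close> is the Schur complement of \<open>K\<close> after eliminating the first \<open>n\<close>
  indices. The factor is lower triangular, so every sum is finite even though the matrix is not;
  a zero pivot does no harm, because then its whole column vanishes and \<open>x / 0 = 0\<close>.\<close>

lemma pd_kernel_cholesky:
  fixes K :: "nat \<Rightarrow> nat \<Rightarrow> real"
  assumes K: "pd_kernel UNIV K"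
  obtains L where "\<And>i n. i < n \<Longrightarrow> L i n = 0"
    and "\<And>i j n. i < n \<Longrightarrow> K i j = (\<Sum>m<n. L i m * L j m)"
proof -
  define Q where "Q = rec_nat K (\<lambda>n H i j. H i j - H i n * H j n / H n n)"
  have Q0: "Q 0 = K" and QS: "Q (Suc n) i j = Q n i j - Q n i n * Q n j n / Q n n n" for n i j
    by (simp_all add: Q_def)
  have pd: "pd_kernel UNIV (Q n)" for n
  proof (induction n)
    case (Suc n)
    then show ?case using pd_kernel_schur[OF Suc, of n] by (simp add: QS[abs_def])
  qed (simp add: Q0 K)
  have zero: "Q n n n = 0 \<Longrightarrow> Q n i n = 0" for n i
    using pd_kernel_diag_zero[OF pd] by simp
  \<comment> \<open>Elimination of index \<open>n\<close> clears row \<open>n\<close>, and rows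
    cleared earlier stay zero because their correction term has a factor
    \<open>Q n i n = 0\<close>.\<close>
  have tri: "i < n \<Longrightarrow> Q n i j = 0" for n i j
  proof (induction n arbitrary: i j)
    case (Suc n)
    show ?case
    proof (cases "i < n")
      case True
      then show ?thesis by (simp add: QS Suc.IH)
    next
      case False
      with Suc.prems have "i = n" by simp
      then show ?thesis
        using zero[of n j] pd_kernel_sym[OF pd, of n j n] by (auto simp: QS)
    qed
  qed simp
  define L where "L i n = Q n i n / sqrt (Q n n n)" for i n
  have LL: "L i n * L j n = Q n i n * Q n j n / Q n n n" for i j n
    using pd_kernel_diag_nonneg[OF pd, of n n] by (simp add: L_def)
  \<comment> \<open>Each elimination removes the rank one kernel \<open>L i n * L j n\<close>, so
    the recursion telescopes.\<close>
  have K_eq: "K i j = (\<Sum>m<n. L i m * L j m) + Q n i j" for i j n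
    by (induction n) (simp_all add: Q0 QS LL)
  show ?thesis
  proof (rule that[of L])
    show "L i n = 0" if "i < n" for i n
      using tri[OF that] by (simp add: L_def)
    show "K i j = (\<Sum>m<n. L i m * L j m)" if "i < n" for i j n
      using K_eq[of i j n] tri[OF that] by simp
  qed
qed

text \<open>The vectors are the rows of a Cholesky factor of \<open>K\<close> along an enumeration
  of \<open>X\<close>. They have finite support, so no convergence question arises. For finite
  \<open>X\<close> the enumeration repeats points, which positive definiteness allows.\<close>

lemma pd_kernel_realization:
  assumes K: "pd_kernel X K" and X: "countable X" "X \<noteq> {}"
  obtains f :: "'x \<Rightarrow> nat \<Rightarrow> real" where
    "\<And>x. x \<in> X \<Longrightarrow> summable (\<lambda>n. (f x n)\<^sup>2)"
    "\<And>x y. x \<in> X \<Longrightarrow> y \<in> X \<Longrightarrow> (\<lambda>n. (f x n - f y n)\<^sup>2) sums (K x x + K y y - 2 * K x y)"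
proof -
  let ?g = "from_nat_into X"
  have gX: "?g i \<in> X" for i
    using X by (simp add: from_nat_into)
  have "pd_kernel UNIV (\<lambda>i j. K (?g i) (?g j))"
    using K gX unfolding pd_kernel_def
    by (auto dest: spec[of _ "\<lambda>i. ?g (h i)" for h])
  then obtain L where L0: "\<And>i n. i < n \<Longrightarrow> L i n = 0"
    and L: "\<And>i j n. i < n \<Longrightarrow> K (?g i) (?g j) = (\<Sum>m<n. L i m * L j m)"
    using pd_kernel_cholesky by blast
  define f where "f x = L (to_nat_on X x)" for x
  have K_eq: "K x y = (\<Sum>m<n. f x m * f y m)" if "x \<in> X" "y \<in> X" "to_nat_on X x < n" for x y n
    using L[of "to_nat_on X x" n "to_nat_on X y"] that X by (simp add: f_def)
  show ?thesis
  proof (rule that[of f])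
    fix x assume "x \<in> X"
    show "summable (\<lambda>n. (f x n)\<^sup>2)"
      by (rule summable_finite[of "{..to_nat_on X x}"]) (auto simp: f_def L0)
  next
    fix x y assume xy: "x \<in> X" "y \<in> X"
    define N where "N = Suc (max (to_nat_on X x) (to_nat_on X y))"
    have "(\<lambda>n. (f x n - f y n)\<^sup>2) sums (\<Sum>n<N. (f x n - f y n)\<^sup>2)"
      by (rule sums_finite) (auto simp: f_def L0 N_def)
    also have "(\<Sum>n<N. (f x n - f y n)\<^sup>2) = K x x + K y y - 2 * K x y"
    proof -
      have "K x x = (\<Sum>m<N. f x m * f x m)" "K y y = (\<Sum>m<N. f y m * f y m)" "K x y = (\<Sum>m<N. f x m * f y m)"
        using xy by (auto intro!: K_eq simp: N_def less_Suc_eq_le simp del: sum.lessThan_Suc)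
      then show ?thesis
        by (simp add: power2_eq_square algebra_simps sum.distrib sum_subtractf sum_distrib_left)
    qed
    finally show "(\<lambda>n. (f x n - f y n)\<^sup>2) sums (K x x + K y y - 2 * K x y)" .
  qed
qed

section \<open>From a sequence of positive definite kernels to a uniform embedding\<close>

text \<open>Upper bound: terms with \<open>n < d x y\<close> contribute at most 2 each to the sum of
  \<open>1 - u n x y\<close>, the others at most a geometric series. Lower bound: every
  \<open>n\<close> whose kernel has decayed at distance \<open>d x y\<close> contributes at least
  1/2, and the number of such \<open>n\<close> tends to infinity with the distance.\<close>

lemma pd_kernels_uniform_embedding:
  fixes u :: "nat \<Rightarrow> 'x \<Rightarrow> 'x \<Rightarrow> real" and d :: "'x \<Rightarrow> 'x \<Rightarrow> nat"
  assumes X: "countable X" "X \<noteq> {}"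
    and pd: "\<And>n. pd_kernel X (u n)"
    and diag: "\<And>n x. x \<in> X \<Longrightarrow> u n x x = 1"
    and close: "\<And>n x y. x \<in> X \<Longrightarrow> y \<in> X \<Longrightarrow> d x y \<le> n \<Longrightarrow> \<bar>1 - u n x y\<bar> \<le> (1/2) ^ n"
    and decay: "\<And>n. \<exists>R. \<forall>x\<in>X. \<forall>y\<in>X. R \<le> d x y \<longrightarrow> u n x y \<le> 1/2"
  shows "\<exists>f :: 'x \<Rightarrow> nat \<Rightarrow> real. (\<forall>x\<in>X. summable (\<lambda>n. (f x n)\<^sup>2)) \<and>
    (\<exists>\<rho>m \<rho>p. proper_control \<rho>m \<and> proper_control \<rho>p \<and>
      (\<forall>x\<in>X. \<forall>y\<in>X. \<rho>m (real (d x y)) \<le> l2seq_dist (f x) (f y) \<and>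
         l2seq_dist (f x) (f y) \<le> \<rho>p (real (d x y))))"
proof -
  obtain e where e: "e \<in> X" using X by blast
  have summ: "summable (\<lambda>n. 1 - u n x y)" if "x \<in> X" "y \<in> X" for x y
    by (rule summable_comparison_test'[of "\<lambda>n. (1/2) ^ n" "d x y"])
      (use close that in \<open>auto simp: summable_geometric\<close>)
  have le1: "\<bar>u n x y\<bar> \<le> 1" if "x \<in> X" "y \<in> X" for n x y
    using pd_kernel_abs_le_1[OF pd that] diag that by simp
  \<comment> \<open>Since \<open>u n x y\<close> tends to 1, the kernels \<open>u n\<close> cannot
    be summed. Centring at \<open>e\<close> makes them summable and leaves the distances
    unchanged.\<close>
  define k where "k n x y = u n x y - u n x e - u n y e + u n e e" for n x y
  define K where "K x y = (\<Sum>n. k n x y)" for x y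
  have k_eq: "k n x y = (1 - u n x e) + (1 - u n y e) - (1 - u n x y)" for n x y
    by (simp add: k_def diag e)
  have summ_k: "summable (\<lambda>n. k n x y)" if "x \<in> X" "y \<in> X" for x y
    unfolding k_eq by (intro summable_diff summable_add summ that e)
  have "pd_kernel X K"
    unfolding K_def using pd_kernel_center[OF pd e] summ_k
    by (intro pd_kernel_suminf) (simp_all add: k_def)
  then obtain f :: "'x \<Rightarrow> nat \<Rightarrow> real" where f: "\<And>x. x \<in> X \<Longrightarrow> summable (\<lambda>n. (f x n)\<^sup>2)"
    "\<And>x y. x \<in> X \<Longrightarrow> y \<in> X \<Longrightarrow> (\<lambda>n. (f x n - f y n)\<^sup>2) sums (K x x + K y y - 2 * K x y)"
    using pd_kernel_realization X by blast
  define \<delta> where "\<delta> x y = (\<Sum>n. 1 - u n x y)" for x y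
  have dist: "l2seq_dist (f x) (f y) = sqrt (2 * \<delta> x y)" if xy: "x \<in> X" "y \<in> X" for x y
  proof -
    have "(\<lambda>n. k n x x + k n y y - 2 * k n x y) sums (K x x + K y y - 2 * K x y)"
      unfolding K_def by (intro sums_diff sums_add sums_mult summable_sums summ_k xy)
    moreover have "(\<lambda>n. k n x x + k n y y - 2 * k n x y) = (\<lambda>n. 2 * (1 - u n x y))"
      using xy by (simp add: k_def diag e fun_eq_iff)
    moreover have "(\<lambda>n. 2 * (1 - u n x y)) sums (2 * \<delta> x y)"
      unfolding \<delta>_def by (intro sums_mult summable_sums summ xy)
    ultimately have "K x x + K y y - 2 * K x y = 2 * \<delta> x y"
      using sums_unique2 by metis
    then show ?thesis
      using sums_unique[OF f(2)[OF xy]] by (simp add: l2seq_dist_def)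
  qed
  obtain R where R: "\<And>n x y. x \<in> X \<Longrightarrow> y \<in> X \<Longrightarrow> R n \<le> d x y \<Longrightarrow> u n x y \<le> 1/2"
    using decay by metis
  \<comment> \<open>The partial sums make the radii monotone while dominating \<open>R n\<close>;
    the summand \<open>n\<close> makes them unbounded, so that each \<open>A t\<close> below is
    finite.\<close>
  define R' where "R' n = n + (\<Sum>m\<le>n. R m)" for n
  have R'_ge: "R n \<le> R' n" "n \<le> R' n" for n
    unfolding R'_def using member_le_sum[of n "{..n}" R] by auto
  have R'_mono: "R' m \<le> R' n" if "m \<le> n" for m n
    unfolding R'_def using that by (intro add_mono sum_mono2) auto
  define A where "A t = {n. real (R' n) \<le> t}" for t
  have finA: "finite (A t)" for t
  proof (rule finite_subset)
    show "A t \<subseteq> {..nat \<lceil>t\<rceil>}"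
    proof
      fix n assume "n \<in> A t"
      then have "real n \<le> t" using R'_ge(2)[of n] by (simp add: A_def)
      then show "n \<in> {..nat \<lceil>t\<rceil>}" by (simp; linarith)
    qed
  qed simp
  have A_mono: "A s \<subseteq> A t" if "s \<le> t" for s t
    using that by (auto simp: A_def)
  have upper: "\<delta> x y \<le> 2 * real (d x y) + 2" if xy: "x \<in> X" "y \<in> X" for x y
  proof (rule sums_le)
    show "(\<lambda>n. 1 - u n x y) sums \<delta> x y"
      unfolding \<delta>_def by (intro summable_sums summ xy)
    have "(\<lambda>n. if n < d x y then 2 else 0) sums (\<Sum>n | n < d x y. 2 :: real)"
      by (rule sums_If_finite) simp
    moreover have "(\<lambda>n. (1/2) ^ n) sums (2 :: real)"
      using geometric_sums[of "1/2 :: real"] by simp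
    ultimately show "(\<lambda>n. (if n < d x y then 2 else 0) + (1/2) ^ n) sums (2 * real (d x y) + 2)"
      using sums_add[of "\<lambda>n. if n < d x y then 2 else 0" _ "\<lambda>n. (1/2) ^ n" "2 :: real"]
      by (simp add: mult.commute)
    show "1 - u n x y \<le> (if n < d x y then 2 else 0) + (1/2) ^ n" for n
    proof (cases "n < d x y")
      case True
      have "0 \<le> (1/2 :: real) ^ n" by simp
      with True show ?thesis using le1[OF xy, of n] by (simp; linarith)
    next
      case False
      then show ?thesis using close[OF xy, of n] by (simp; linarith)
    qed
  qed
  have lower: "real (card (A (real (d x y)))) \<le> 2 * \<delta> x y" if xy: "x \<in> X" "y \<in> X" for x y
  proof -
    have "(\<Sum>n\<in>A (real (d x y)). 1/2) \<le> (\<Sum>n\<in>A (real (d x y)). 1 - u n x y)"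
    proof (rule sum_mono)
      fix n assume "n \<in> A (real (d x y))"
      then have "R n \<le> d x y" using R'_ge(1)[of n] by (simp add: A_def)
      then show "1/2 \<le> 1 - u n x y" using R[OF xy, of n] by simp
    qed
    also have "\<dots> \<le> \<delta> x y"
      unfolding \<delta>_def using le1[OF xy] by (intro sum_le_suminf summ xy finA) (auto simp: abs_le_iff)
    finally show ?thesis by simp
  qed
  have "proper_control (\<lambda>t. sqrt (real (card (A t))))"
    unfolding proper_control_def
  proof (intro conjI allI impI)
    show "mono_on {0..} (\<lambda>t. sqrt (real (card (A t))))"
      by (intro mono_onI) (simp add: card_mono finA A_mono)
    have "filterlim (\<lambda>t. real (card (A t))) at_top at_top"
      unfolding filterlim_at_top
    proof
      fix Z :: real
      show "\<forall>\<^sub>F t in at_top. Z \<le> real (card (A t))"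
        using eventually_ge_at_top[of "real (R' (nat \<lceil>Z\<rceil>))"]
      proof eventually_elim
        case (elim t)
        \<comment> \<open>By monotonicity of \<open>R'\<close>, once \<open>t\<close> passes one
          radius it has passed all earlier ones.\<close>
        have "{..<nat \<lceil>Z\<rceil>} \<subseteq> A t"
        proof
          fix n assume "n \<in> {..<nat \<lceil>Z\<rceil>}"
          then have "real (R' n) \<le> real (R' (nat \<lceil>Z\<rceil>))" using R'_mono[of n "nat \<lceil>Z\<rceil>"] by simp
          then show "n \<in> A t" using elim by (simp add: A_def)
        qed
        then have "nat \<lceil>Z\<rceil> \<le> card (A t)"
          using card_mono[OF finA] by (metis card_lessThan)
        then show ?case by linarith
      qed
    qed
    then show "filterlim (\<lambda>t. sqrt (real (card (A t)))) at_top at_top"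
      by (rule filterlim_compose[OF sqrt_at_top])
  qed simp
  moreover have "proper_control (\<lambda>t. sqrt (4 * t + 4))"
    unfolding proper_control_def
  proof (intro conjI allI impI)
    have "filterlim (\<lambda>t::real. 4 * t + 4) at_top at_top"
      by (rule filterlim_at_top_mono[OF filterlim_ident])
        (auto intro: eventually_mono[OF eventually_ge_at_top[of 0]])
    then show "filterlim (\<lambda>t::real. sqrt (4 * t + 4)) at_top at_top"
      by (rule filterlim_compose[OF sqrt_at_top])
  qed (auto intro!: mono_onI)
  moreover have "sqrt (real (card (A (real (d x y))))) \<le> l2seq_dist (f x) (f y)"
    "l2seq_dist (f x) (f y) \<le> sqrt (4 * real (d x y) + 4)" if "x \<in> X" "y \<in> X" for x y
    using lower[OF that] upper[OF that] by (simp_all add: dist[OF that])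
  ultimately show ?thesis
    using f(1) by (intro exI[of _ f] conjI exI[of _ "\<lambda>t. sqrt (real (card (A t)))"]
      exI[of _ "\<lambda>t. sqrt (4 * t + 4)"]) auto
qed

section \<open>Finite dimensional spaces of functions\<close>

text \<open>A finite dimensional space of functions has a basis dual to evaluation at finitely many
  points. The coordinates of \<open>v\<close> are then values of \<open>v\<close>, so a pointwise
  bound on \<open>v\<close> bounds its coordinates directly. The induction removes one spanning
  function at a time.\<close>

lemma linear_subspace_dual_points:
  fixes F :: "('x \<Rightarrow> complex) set"
  assumes "finite F"
    and "\<And>v w a b. v \<in> V \<Longrightarrow> w \<in> V \<Longrightarrow> (\<lambda>x. a * v x + b * w x) \<in> V"
    and "\<And>v. v \<in> V \<Longrightarrow> \<exists>c. v = (\<lambda>x. \<Sum>f\<in>F. c f * f x)"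
  shows "\<exists>P h. finite P \<and> (\<forall>p\<in>P. h p \<in> V) \<and> (\<forall>p\<in>P. \<forall>q\<in>P. h p q = (if p = q then 1 else 0)) \<and>
    (\<forall>v\<in>V. \<forall>x. v x = (\<Sum>p\<in>P. v p * h p x))"
  using assms
proof (induction F arbitrary: V rule: finite_induct)
  case empty
  then have "\<forall>v\<in>V. \<forall>x. v x = 0" by fastforce
  then show ?case by (intro exI[of _ "{}"]) auto
next
  case (insert f0 F)
  note lin = insert.prems(1)
  \<comment> \<open>The elements of \<open>V\<close> expressible without \<open>f0\<close>; this
    subspace has codimension at most one in \<open>V\<close>.\<close>
  define U where "U = {v \<in> V. \<exists>c. v = (\<lambda>x. \<Sum>f\<in>F. c f * f x)}"
  have U_lin: "(\<lambda>x. a * v x + b * w x) \<in> U" if "v \<in> U" "w \<in> U" for v w a b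
  proof -
    from that obtain c d where "v = (\<lambda>x. \<Sum>f\<in>F. c f * f x)" "w = (\<lambda>x. \<Sum>f\<in>F. d f * f x)"
      unfolding U_def by blast
    then have "(\<lambda>x. a * v x + b * w x) = (\<lambda>x. \<Sum>f\<in>F. (a * c f + b * d f) * f x)"
      by (simp add: sum_distrib_left sum.distrib algebra_simps)
    then have "\<exists>k. (\<lambda>x. a * v x + b * w x) = (\<lambda>x. \<Sum>f\<in>F. k f * f x)"
      by (intro exI[of _ "\<lambda>f. a * c f + b * d f"])
    moreover have "v \<in> V" "w \<in> V"
      using that by (auto simp: U_def)
    ultimately show ?thesis
      using lin unfolding U_def by blast
  qed
  have IH: "\<exists>P h. finite P \<and> (\<forall>p\<in>P. h p \<in> U) \<and> (\<forall>p\<in>P. \<forall>q\<in>P. h p q = (if p = q then 1 else 0)) \<and>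
      (\<forall>v\<in>U. \<forall>x. v x = (\<Sum>p\<in>P. v p * h p x))"
  proof (rule insert.IH)
    show "(\<lambda>x. a * v x + b * w x) \<in> U" if "v \<in> U" "w \<in> U" for v w a b
      using that by (rule U_lin)
    show "\<exists>c. v = (\<lambda>x. \<Sum>f\<in>F. c f * f x)" if "v \<in> U" for v
      using that unfolding U_def by blast
  qed
  then obtain P h where P: "finite P" and h: "\<forall>p\<in>P. h p \<in> U"
    and dual: "\<forall>p\<in>P. \<forall>q\<in>P. h p q = (if p = q then 1 else 0)"
    and rep: "\<forall>v\<in>U. \<forall>x. v x = (\<Sum>p\<in>P. v p * h p x)"
    by (elim exE conjE) (rule that)
  show ?case
  proof (cases "V \<subseteq> U")
    case True
    then have "U = V" by (auto simp: U_def)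
    with IH show ?thesis by (simp only:)
  next
    case False
    then obtain w0 where w0: "w0 \<in> V" "w0 \<notin> U" by blast
    have "(\<lambda>x. 0) \<in> V" using lin[OF w0(1) w0(1), of 0 0] by simp
    then have U0: "(\<lambda>x. 0) \<in> U" by (auto simp: U_def intro!: exI[of _ "\<lambda>_. 0"])
    have sum_mem: "(\<lambda>x. \<Sum>p\<in>Q. k p * h p x) \<in> U" if "Q \<subseteq> P" for k Q
      using finite_subset[OF that P] that
    proof (induction Q rule: finite_induct)
      case empty
      show ?case using U0 by simp
    next
      case (insert p Q)
      then have "h p \<in> U" "(\<lambda>x. \<Sum>p\<in>Q. k p * h p x) \<in> U"
        using h by auto
      then have "(\<lambda>x. k p * h p x + 1 * (\<Sum>p\<in>Q. k p * h p x)) \<in> U"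
        by (rule U_lin)
      then show ?case using insert.hyps by simp
    qed
    have UV: "v \<in> U \<Longrightarrow> v \<in> V" for v by (simp add: U_def)
    \<comment> \<open>Subtracting the interpolant of \<open>w0\<close> at \<open>P\<close> gives a
      function vanishing on \<open>P\<close> but still outside \<open>U\<close>. A point where it is
      nonzero becomes the new evaluation point \<open>q\<close>.\<close>
    define w1 where "w1 = (\<lambda>x. 1 * w0 x + (-1) * (\<Sum>p\<in>P. w0 p * h p x))"
    have w1V: "w1 \<in> V"
      unfolding w1_def by (rule lin[OF w0(1) UV[OF sum_mem[OF order_refl]]])
    have w1U: "w1 \<notin> U"
    proof
      assume "w1 \<in> U"
      then have "(\<lambda>x. 1 * w1 x + 1 * (\<Sum>p\<in>P. w0 p * h p x)) \<in> U"
        by (rule U_lin[OF _ sum_mem[OF order_refl]])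
      then show False using w0(2) by (simp add: w1_def)
    qed
    have w1P: "w1 p = 0" if "p \<in> P" for p
      using that P by (simp add: w1_def dual if_distrib[where f="\<lambda>y. _ * y"] sum.delta cong: if_cong)
    obtain q where q: "w1 q \<noteq> 0"
      using w1U U0 by (metis ext)
    have qP: "q \<notin> P" using q w1P by blast
    define w where "w = (\<lambda>x. w1 x / w1 q)"
    have wV: "w \<in> V"
      using lin[OF w1V w1V, of "1 / w1 q" 0] by (simp add: w_def)
    have wP: "p \<in> P \<Longrightarrow> w p = 0" for p by (simp add: w_def w1P)
    have wq: "w q = 1" using q by (simp add: w_def)
    \<comment> \<open>The multiple of \<open>w\<close> is chosen to cancel the coefficient of
      \<open>f0\<close>; the coefficient \<open>b f0\<close> of \<open>w1\<close> is nonzero because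
      \<open>w1\<close> lies outside \<open>U\<close>.\<close>
    have mod: "\<exists>c. (\<lambda>x. 1 * v x + (- c) * w x) \<in> U" if v: "v \<in> V" for v
    proof -
      obtain a b where a: "v = (\<lambda>x. \<Sum>f\<in>insert f0 F. a f * f x)"
        and b: "w1 = (\<lambda>x. \<Sum>f\<in>insert f0 F. b f * f x)"
        using insert.prems(2)[OF v] insert.prems(2)[OF w1V] by blast
      have b0: "b f0 \<noteq> 0"
      proof
        assume "b f0 = 0"
        then have "w1 = (\<lambda>x. \<Sum>f\<in>F. b f * f x)" using b insert.hyps by simp
        then show False using w1U w1V by (auto simp: U_def)
      qed
      define c where "c = a f0 / b f0 * w1 q"
      have cw: "c * w x = (a f0 / b f0) * w1 x" for x using q by (simp add: c_def w_def)
      have "1 * v x + (- c) * w x = (\<Sum>f\<in>F. (a f - a f0 / b f0 * b f) * f x)" for x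
      proof -
        have "1 * v x + (- c) * w x = v x - (a f0 / b f0) * w1 x"
          using cw[of x] by simp
        also have "\<dots> = (\<Sum>f\<in>F. a f * f x) - (a f0 / b f0) * (\<Sum>f\<in>F. b f * f x)"
          using insert.hyps b0 unfolding a b by (simp add: algebra_simps)
        finally show ?thesis
          by (simp add: sum_distrib_left sum_subtractf algebra_simps)
      qed
      then have "\<exists>c'. (\<lambda>x. 1 * v x + (- c) * w x) = (\<lambda>x. \<Sum>f\<in>F. c' f * f x)"
        by (intro exI[of _ "\<lambda>f. a f - a f0 / b f0 * b f"] ext)
      then show ?thesis
        using lin[OF v wV] unfolding U_def by blast
    qed
    \<comment> \<open>The old basis functions are corrected to vanish at \<open>q\<close>; as
      \<open>w\<close> vanishes on \<open>P\<close>, their values there do not change.\<close>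
    define h' where "h' p = (if p = q then w else (\<lambda>x. 1 * h p x + (- h p q) * w x))" for p
    have "v x = (\<Sum>p\<in>insert q P. v p * h' p x)" if v: "v \<in> V" for v x
    proof -
      obtain c where c: "(\<lambda>x. 1 * v x + (- c) * w x) \<in> U"
        using mod[OF v] by blast
      have v_eq: "v y = c * w y + (\<Sum>p\<in>P. v p * h p y)" for y
        using rep[rule_format, OF c, of y] by (simp add: wP algebra_simps)
      have "(\<Sum>p\<in>insert q P. v p * h' p x) = v q * w x + (\<Sum>p\<in>P. v p * h' p x)"
        using P qP by (simp add: h'_def)
      also have "(\<Sum>p\<in>P. v p * h' p x) = (\<Sum>p\<in>P. v p * (h p x - h p q * w x))"
        using qP by (intro sum.cong) (auto simp: h'_def)
      also have "\<dots> = (\<Sum>p\<in>P. v p * h p x) - (\<Sum>p\<in>P. v p * h p q) * w x"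
        by (simp add: right_diff_distrib sum_subtractf sum_distrib_right mult.assoc)
      also have "v q * w x = (c + (\<Sum>p\<in>P. v p * h p q)) * w x"
        using v_eq[of q] wq by simp
      finally show ?thesis using v_eq[of x] by (simp add: algebra_simps)
    qed
    moreover have "h' p \<in> V" if "p \<in> insert q P" for p
    proof (cases "p = q")
      case False
      then have "h p \<in> V" using that h UV by blast
      then have "(\<lambda>x. 1 * h p x + (- h p q) * w x) \<in> V"
        using wV by (rule lin)
      then show ?thesis using False by (simp add: h'_def)
    qed (simp add: h'_def wV)
    moreover have "h' p r = (if p = r then 1 else 0)" if "p \<in> insert q P" "r \<in> insert q P" for p r
      using that qP wP wq dual by (auto simp: h'_def)
    ultimately show ?thesis
      using P by (intro exI[of _ "insert q P"] exI[of _ h']) auto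
  qed
qed

section \<open>Operators on l2\<close>

lemma infsum_single_support:
  assumes "t \<in> X" "\<And>x. x \<in> X \<Longrightarrow> x \<noteq> t \<Longrightarrow> f x = 0"
  shows "f summable_on X" "infsum f X = f t"
proof -
  have "f summable_on X \<longleftrightarrow> f summable_on {t}"
    by (rule summable_on_cong_neutral) (use assms in auto)
  then show "f summable_on X" by simp
  have "infsum f X = infsum f {t}"
    by (rule infsum_cong_neutral) (use assms in auto)
  then show "infsum f X = f t" by simp
qed

lemma has_sum_finite_sum:
  fixes f :: "'i \<Rightarrow> 'x \<Rightarrow> complex"
  assumes "finite I" "\<And>i. i \<in> I \<Longrightarrow> (f i has_sum s i) X"
  shows "((\<lambda>x. \<Sum>i\<in>I. f i x) has_sum (\<Sum>i\<in>I. s i)) X"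
  using assms by (induction I rule: finite_induct) (auto intro!: has_sum_add)

lemma l2_zero: "\<xi> \<in> l2 G \<Longrightarrow> x \<notin> carrier G \<Longrightarrow> \<xi> x = 0"
  by (simp add: l2_def)

lemma l2_summable: "\<xi> \<in> l2 G \<Longrightarrow> (\<lambda>x. (cmod (\<xi> x))\<^sup>2) summable_on carrier G"
  by (simp add: l2_def)

lemma l2norm_nonneg: "0 \<le> l2norm G \<xi>"
  unfolding l2norm_def by (simp add: infsum_nonneg)

lemma l2norm_square: "(l2norm G \<xi>)\<^sup>2 = (\<Sum>\<^sub>\<infinity>x\<in>carrier G. (cmod (\<xi> x))\<^sup>2)"
  unfolding l2norm_def by (simp add: infsum_nonneg)

lemma l2_product_summable:
  assumes "(\<lambda>x. (cmod (\<xi> x))\<^sup>2) summable_on X" "(\<lambda>x. (cmod (\<eta> x))\<^sup>2) summable_on X"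
  shows "(\<lambda>x. \<xi> x * \<eta> x) summable_on X"
  by (rule abs_summable_summable, rule abs_summable_product)
    (use assms in \<open>simp_all add: norm_mult power2_eq_square\<close>)

lemma l2_entry_le_l2norm:
  assumes "\<xi> \<in> l2 G"
  shows "cmod (\<xi> x) \<le> l2norm G \<xi>"
proof (cases "x \<in> carrier G")
  case True
  have "(\<Sum>y\<in>{x}. (cmod (\<xi> y))\<^sup>2) \<le> (l2norm G \<xi>)\<^sup>2"
    unfolding l2norm_square by (rule finite_sum_le_infsum) (use True l2_summable[OF assms] in auto)
  then show ?thesis
    using l2norm_nonneg by (auto intro: power2_le_imp_le)
qed (use l2_zero[OF assms] l2norm_nonneg in auto)

text \<open>Both parts follow pointwise from |z + w|^2 <= 2|z|^2 + 2|w|^2. The factor 2 is harmless,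
  since the estimate only serves to show that combinations of bounded operators are bounded.\<close>

lemma l2_combination:
  assumes \<xi>: "\<xi> \<in> l2 G" and \<eta>: "\<eta> \<in> l2 G"
  shows "(\<lambda>x. a * \<xi> x + b * \<eta> x) \<in> l2 G"
    and "(l2norm G (\<lambda>x. a * \<xi> x + b * \<eta> x))\<^sup>2 \<le>
      2 * (cmod a)\<^sup>2 * (l2norm G \<xi>)\<^sup>2 + 2 * (cmod b)\<^sup>2 * (l2norm G \<eta>)\<^sup>2"
proof -
  let ?g = "\<lambda>x. 2 * (cmod a)\<^sup>2 * (cmod (\<xi> x))\<^sup>2 + 2 * (cmod b)\<^sup>2 * (cmod (\<eta> x))\<^sup>2"
  have le: "(cmod (a * \<xi> x + b * \<eta> x))\<^sup>2 \<le> ?g x" for x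
  proof -
    have "(cmod (a * \<xi> x + b * \<eta> x))\<^sup>2 \<le> (cmod (a * \<xi> x) + cmod (b * \<eta> x))\<^sup>2"
      by (intro power_mono norm_triangle_ineq) simp
    also have "\<dots> \<le> 2 * (cmod (a * \<xi> x))\<^sup>2 + 2 * (cmod (b * \<eta> x))\<^sup>2"
      using sum_squares_bound[of "cmod (a * \<xi> x)" "cmod (b * \<eta> x)"] by (simp add: power2_sum)
    finally show ?thesis by (simp add: norm_mult power_mult_distrib)
  qed
  have sg: "?g summable_on carrier G"
    by (intro summable_on_add summable_on_cmult_right l2_summable assms)
  have s: "(\<lambda>x. (cmod (a * \<xi> x + b * \<eta> x))\<^sup>2) summable_on carrier G"
    by (rule summable_on_comparison_test[OF sg]) (use le in auto)
  then show "(\<lambda>x. a * \<xi> x + b * \<eta> x) \<in> l2 G"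
    using l2_zero[OF \<xi>] l2_zero[OF \<eta>] by (simp add: l2_def)
  have "infsum ?g (carrier G) = 2 * (cmod a)\<^sup>2 * (l2norm G \<xi>)\<^sup>2 + 2 * (cmod b)\<^sup>2 * (l2norm G \<eta>)\<^sup>2"
    unfolding l2norm_square
    by (simp add: infsum_add infsum_cmult_right' summable_on_cmult_right l2_summable assms)
  then show "(l2norm G (\<lambda>x. a * \<xi> x + b * \<eta> x))\<^sup>2 \<le>
      2 * (cmod a)\<^sup>2 * (l2norm G \<xi>)\<^sup>2 + 2 * (cmod b)\<^sup>2 * (l2norm G \<eta>)\<^sup>2"
    using infsum_mono[OF s sg le] by (simp add: l2norm_square)
qed

lemma l2_point_mass:
  assumes "t \<in> carrier G"
  shows "(\<lambda>x. if x = t then c else 0) \<in> l2 G" "l2norm G (\<lambda>x. if x = t then c else 0) = cmod c"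
  using assms infsum_single_support[of t "carrier G" "\<lambda>x. (cmod (if x = t then c else 0))\<^sup>2"]
  by (auto simp: l2_def l2norm_def)

lemma kapply_point_mass:
  assumes "s \<in> carrier G" "t \<in> carrier G"
  shows "kapply G A (\<lambda>x. if x = t then c else 0) s = A s t * c"
  using assms infsum_single_support(2)[of t "carrier G" "\<lambda>r. A s r * (if r = t then c else 0)"]
  by (simp add: kapply_def)

lemma l2inner_point_mass:
  assumes "t \<in> carrier G"
  shows "l2inner G \<xi> (\<lambda>x. if x = t then c else 0) = \<xi> t * cnj c"
  using assms infsum_single_support(2)[of t "carrier G" "\<lambda>x. \<xi> x * cnj (if x = t then c else 0)"]
  by (simp add: l2inner_def)

lemma bounded_op_row: "bounded_op G A \<Longrightarrow> s \<in> carrier G \<Longrightarrow> A s \<in> l2 G"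
  by (simp add: bounded_op_def)

lemma bounded_op_zero: "bounded_op G A \<Longrightarrow> s \<notin> carrier G \<or> r \<notin> carrier G \<Longrightarrow> A s r = 0"
  by (simp add: bounded_op_def)

lemma bounded_op_combination:
  assumes A: "bounded_op G A" and B: "bounded_op G B"
  shows "bounded_op G (\<lambda>s r. a * A s r + b * B s r)"
proof -
  obtain C where C: "\<And>\<xi>. \<xi> \<in> l2 G \<Longrightarrow> kapply G A \<xi> \<in> l2 G"
    "\<And>\<xi>. \<xi> \<in> l2 G \<Longrightarrow> l2norm G (kapply G A \<xi>) \<le> C * l2norm G \<xi>"
    using A unfolding bounded_op_def by blast
  obtain D where D: "\<And>\<xi>. \<xi> \<in> l2 G \<Longrightarrow> kapply G B \<xi> \<in> l2 G"
    "\<And>\<xi>. \<xi> \<in> l2 G \<Longrightarrow> l2norm G (kapply G B \<xi>) \<le> D * l2norm G \<xi>"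
    using B unfolding bounded_op_def by blast
  let ?E = "2 * (cmod a)\<^sup>2 * C\<^sup>2 + 2 * (cmod b)\<^sup>2 * D\<^sup>2"
  have "kapply G (\<lambda>s r. a * A s r + b * B s r) \<xi> \<in> l2 G \<and>
      l2norm G (kapply G (\<lambda>s r. a * A s r + b * B s r) \<xi>) \<le> sqrt ?E * l2norm G \<xi>"
    if \<xi>: "\<xi> \<in> l2 G" for \<xi>
  proof -
    have eq: "kapply G (\<lambda>s r. a * A s r + b * B s r) \<xi> = (\<lambda>s. a * kapply G A \<xi> s + b * kapply G B \<xi> s)"
    proof
      fix s
      have "(\<Sum>\<^sub>\<infinity>r\<in>carrier G. (a * A s r + b * B s r) * \<xi> r)
          = a * (\<Sum>\<^sub>\<infinity>r\<in>carrier G. A s r * \<xi> r) + b * (\<Sum>\<^sub>\<infinity>r\<in>carrier G. B s r * \<xi> r)"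
        if s: "s \<in> carrier G"
      proof -
        \<comment> \<open>Rows in l2 make these series absolutely convergent, which justifies
          splitting the infinite sum.\<close>
        have "(\<lambda>r. A s r * \<xi> r) summable_on carrier G" "(\<lambda>r. B s r * \<xi> r) summable_on carrier G"
          using s by (auto intro!: l2_product_summable l2_summable bounded_op_row A B \<xi>)
        then show ?thesis
          by (simp add: distrib_right mult.assoc infsum_add infsum_cmult_right' summable_on_cmult_right)
      qed
      then show "kapply G (\<lambda>s r. a * A s r + b * B s r) \<xi> s = a * kapply G A \<xi> s + b * kapply G B \<xi> s"
        by (simp add: kapply_def)
    qed
    let ?N = "l2norm G \<xi>"
    have "(l2norm G (kapply G A \<xi>))\<^sup>2 \<le> (C * ?N)\<^sup>2" "(l2norm G (kapply G B \<xi>))\<^sup>2 \<le> (D * ?N)\<^sup>2"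
      using C(2) D(2) \<xi> by (auto intro!: power_mono l2norm_nonneg)
    then have "2 * (cmod a)\<^sup>2 * (l2norm G (kapply G A \<xi>))\<^sup>2 + 2 * (cmod b)\<^sup>2 * (l2norm G (kapply G B \<xi>))\<^sup>2
      \<le> 2 * (cmod a)\<^sup>2 * (C * ?N)\<^sup>2 + 2 * (cmod b)\<^sup>2 * (D * ?N)\<^sup>2"
      by (intro add_mono mult_left_mono) auto
    also have "\<dots> = (sqrt ?E * ?N)\<^sup>2"
      by (simp add: power_mult_distrib algebra_simps)
    finally have "(l2norm G (kapply G (\<lambda>s r. a * A s r + b * B s r) \<xi>))\<^sup>2 \<le> (sqrt ?E * ?N)\<^sup>2"
      using l2_combination(2)[OF C(1)[OF \<xi>] D(1)[OF \<xi>], of a b] unfolding eq by linarith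
    moreover have "0 \<le> sqrt ?E * ?N" by (intro mult_nonneg_nonneg l2norm_nonneg) simp
    ultimately show ?thesis
      using l2_combination(1)[OF C(1)[OF \<xi>] D(1)[OF \<xi>], of a b] unfolding eq
      by (auto intro: power2_le_imp_le)
  qed
  moreover have "(\<lambda>r. a * A s r + b * B s r) \<in> l2 G" if "s \<in> carrier G" for s
    using that by (intro l2_combination bounded_op_row A B)
  ultimately show ?thesis
    using bounded_op_zero[OF A] bounded_op_zero[OF B] unfolding bounded_op_def by auto
qed

lemma bounded_op_kdiff: "bounded_op G A \<Longrightarrow> bounded_op G B \<Longrightarrow> bounded_op G (kdiff A B)"
  using bounded_op_combination[of G A B 1 "-1"] by (simp add: kdiff_def)

text \<open>The entry is coordinate \<open>s\<close> of the image of the unit vector at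
  \<open>t\<close>.\<close>

lemma kernel_entry_le_opnorm:
  assumes A: "bounded_op G A" and st: "s \<in> carrier G" "t \<in> carrier G"
  shows "cmod (A s t) \<le> opnorm G A"
proof -
  let ?\<delta> = "\<lambda>x. if x = t then 1 else 0 :: complex"
  obtain C where C: "\<And>\<xi>. \<xi> \<in> l2 G \<Longrightarrow> kapply G A \<xi> \<in> l2 G"
    "\<And>\<xi>. \<xi> \<in> l2 G \<Longrightarrow> l2norm G (kapply G A \<xi>) \<le> C * l2norm G \<xi>"
    using A unfolding bounded_op_def by blast
  \<comment> \<open>A real \<open>SUP\<close> is an upper bound only for a set that is bounded
    above. The constant \<open>C\<close> may be negative, hence its absolute value.\<close>
  have "bdd_above ((\<lambda>\<xi>. l2norm G (kapply G A \<xi>)) ` {\<xi> \<in> l2 G. l2norm G \<xi> \<le> 1})"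
  proof (rule bdd_aboveI2)
    fix \<xi> assume "\<xi> \<in> {\<xi> \<in> l2 G. l2norm G \<xi> \<le> 1}"
    then have \<xi>: "\<xi> \<in> l2 G" "l2norm G \<xi> \<le> 1" by auto
    have "C * l2norm G \<xi> \<le> \<bar>C\<bar> * l2norm G \<xi>"
      by (intro mult_right_mono l2norm_nonneg) simp
    also have "\<dots> \<le> \<bar>C\<bar> * 1" using \<xi>(2) by (intro mult_left_mono) auto
    finally show "l2norm G (kapply G A \<xi>) \<le> \<bar>C\<bar>" using C(2)[OF \<xi>(1)] by simp
  qed
  then have "l2norm G (kapply G A ?\<delta>) \<le> opnorm G A"
    unfolding opnorm_def by (rule cSUP_upper2[OF _ _ order_refl]) (use l2_point_mass[OF st(2), of 1] in auto)
  moreover have "cmod (kapply G A ?\<delta> s) \<le> l2norm G (kapply G A ?\<delta>)"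
    using C(1) l2_point_mass(1)[OF st(2)] by (intro l2_entry_le_l2norm) auto
  ultimately show ?thesis
    using kapply_point_mass[OF st, of A 1] by simp
qed

lemma opnorm_zero: "opnorm G (\<lambda>s r. 0) = 0"
proof -
  have "kapply G (\<lambda>s r. 0) \<xi> = (\<lambda>x. 0)" for \<xi>
    by (simp add: kapply_def fun_eq_iff)
  then have "l2norm G (kapply G (\<lambda>s r. 0) \<xi>) = 0" for \<xi>
    by (simp add: l2norm_def)
  moreover have "(\<lambda>x. 0) \<in> l2 G" "l2norm G (\<lambda>x. 0) \<le> 1"
    by (auto simp: l2_def l2norm_def)
  then have "{\<xi> \<in> l2 G. l2norm G \<xi> \<le> 1} \<noteq> {}" by blast
  ultimately show ?thesis by (simp add: opnorm_def)
qed

section \<open>The regular representation\<close>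

context group
begin

lemma bij_betw_left_mult: "t \<in> carrier G \<Longrightarrow> bij_betw (\<lambda>x. t \<otimes> x) (carrier G) (carrier G)"
  by (rule bij_betw_byWitness[of _ "\<lambda>x. inv t \<otimes> x"]) (auto simp: m_assoc[symmetric])

lemma kapply_lreg:
  assumes "t \<in> carrier G" "s \<in> carrier G"
  shows "kapply G (lreg G t) \<xi> s = \<xi> (inv t \<otimes> s)"
proof -
  have "kapply G (lreg G t) \<xi> s = (\<Sum>\<^sub>\<infinity>r\<in>carrier G. lreg G t s r * \<xi> r)"
    using assms by (simp add: kapply_def)
  also have "\<dots> = lreg G t s (inv t \<otimes> s) * \<xi> (inv t \<otimes> s)"
    by (rule infsum_single_support) (use assms in \<open>auto simp: lreg_def inv_solve_left\<close>)
  finally show ?thesis using assms by (simp add: lreg_def m_assoc[symmetric])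
qed

lemma bounded_op_lreg:
  assumes t: "t \<in> carrier G"
  shows "bounded_op G (lreg G t)"
proof -
  have "lreg G t s \<in> l2 G" if s: "s \<in> carrier G" for s
  proof -
    have "lreg G t s = (\<lambda>x. if x = inv t \<otimes> s then 1 else 0)"
      using s t by (auto simp: lreg_def fun_eq_iff m_assoc[symmetric])
    then show ?thesis using s t l2_point_mass(1)[of "inv t \<otimes> s" G 1] by simp
  qed
  moreover have "kapply G (lreg G t) \<xi> \<in> l2 G \<and> l2norm G (kapply G (lreg G t) \<xi>) \<le> 1 * l2norm G \<xi>"
    if \<xi>: "\<xi> \<in> l2 G" for \<xi>
  proof -
    have bij: "bij_betw (\<lambda>x. inv t \<otimes> x) (carrier G) (carrier G)"
      using t by (intro bij_betw_left_mult) simp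
    have "(\<lambda>x. (cmod (\<xi> (inv t \<otimes> x)))\<^sup>2) summable_on carrier G"
      using summable_on_reindex_bij_betw[OF bij, of "\<lambda>x. (cmod (\<xi> x))\<^sup>2"] l2_summable[OF \<xi>] by simp
    moreover have "(\<lambda>x. (cmod (kapply G (lreg G t) \<xi> x))\<^sup>2) summable_on carrier G \<longleftrightarrow>
        (\<lambda>x. (cmod (\<xi> (inv t \<otimes> x)))\<^sup>2) summable_on carrier G"
      by (rule summable_on_cong) (simp add: kapply_lreg t)
    moreover have "(\<Sum>\<^sub>\<infinity>x\<in>carrier G. (cmod (kapply G (lreg G t) \<xi> x))\<^sup>2) =
        (\<Sum>\<^sub>\<infinity>x\<in>carrier G. (cmod (\<xi> (inv t \<otimes> x)))\<^sup>2)"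
      by (rule infsum_cong) (simp add: kapply_lreg t)
    ultimately show ?thesis
      using infsum_reindex_bij_betw[OF bij, of "\<lambda>x. (cmod (\<xi> x))\<^sup>2"]
      by (simp add: l2_def l2norm_def kapply_def)
  qed
  moreover have "lreg G t s r = 0" if "s \<notin> carrier G \<or> r \<notin> carrier G" for s r
    using that by (auto simp: lreg_def)
  ultimately show ?thesis unfolding bounded_op_def by blast
qed

text \<open>The image of the complex group algebra, dense in \<open>reduced_cstar G\<close>. It
  contains every \<open>lreg G t\<close>, and its linearity is a finite computation without
  limits.\<close>

definition lreg_span :: "'a kernel set" where
  "lreg_span = {x. \<exists>F c. finite F \<and> F \<subseteq> carrier G \<and> x = (\<lambda>s r. \<Sum>t\<in>F. c t * lreg G t s r)}"

lemma lreg_span_combination: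
  assumes "x \<in> lreg_span" "y \<in> lreg_span"
  shows "(\<lambda>s r. a * x s r + b * y s r) \<in> lreg_span"
proof -
  obtain F c where F: "finite F" "F \<subseteq> carrier G" "x = (\<lambda>s r. \<Sum>t\<in>F. c t * lreg G t s r)"
    using assms(1) unfolding lreg_span_def by blast
  obtain H d where H: "finite H" "H \<subseteq> carrier G" "y = (\<lambda>s r. \<Sum>t\<in>H. d t * lreg G t s r)"
    using assms(2) unfolding lreg_span_def by blast
  let ?k = "\<lambda>t. a * (if t \<in> F then c t else 0) + b * (if t \<in> H then d t else 0)"
  have "x = (\<lambda>s r. \<Sum>t\<in>F \<union> H. (if t \<in> F then c t else 0) * lreg G t s r)"
    unfolding F(3) by (intro ext sum.mono_neutral_cong_left) (use F H in auto)
  moreover have "y = (\<lambda>s r. \<Sum>t\<in>F \<union> H. (if t \<in> H then d t else 0) * lreg G t s r)"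
    unfolding H(3) by (intro ext sum.mono_neutral_cong_left) (use F H in auto)
  ultimately have "(\<lambda>s r. a * x s r + b * y s r) = (\<lambda>s r. \<Sum>t\<in>F \<union> H. ?k t * lreg G t s r)"
    by (simp only: sum_distrib_left sum.distrib distrib_right mult.assoc)
  then show ?thesis
    unfolding lreg_span_def using F H by (intro CollectI exI[of _ "F \<union> H"] exI[of _ ?k]) auto
qed

lemma lreg_in_span: "t \<in> carrier G \<Longrightarrow> lreg G t \<in> lreg_span"
  unfolding lreg_span_def by (intro CollectI exI[of _ "{t}"] exI[of _ "\<lambda>_. 1"]) auto

lemma lreg_span_reduced: "lreg_span \<subseteq> reduced_cstar G"
proof
  fix x assume "x \<in> lreg_span"
  then obtain F c where F: "finite F" "F \<subseteq> carrier G" "x = (\<lambda>s r. \<Sum>t\<in>F. c t * lreg G t s r)"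
    unfolding lreg_span_def by blast
  have "bounded_op G (\<lambda>s r. \<Sum>t\<in>F. c t * lreg G t s r)"
    using F(1,2)
  proof (induction F rule: finite_induct)
    case empty
    show ?case
      using bounded_op_combination[OF bounded_op_lreg bounded_op_lreg, of \<one> \<one> 0 0] by simp
  next
    case (insert t F)
    then have "bounded_op G (\<lambda>s r. c t * lreg G t s r + 1 * (\<Sum>t\<in>F. c t * lreg G t s r))"
      by (intro bounded_op_combination bounded_op_lreg) auto
    then show ?case using insert.hyps by simp
  qed
  moreover have "opnorm G (kdiff x (\<lambda>s r. \<Sum>t\<in>F. c t * lreg G t s r)) = 0"
    by (simp add: F(3) kdiff_def opnorm_zero)
  then have "\<exists>F c. finite F \<and> F \<subseteq> carrier G \<and>
      opnorm G (kdiff x (\<lambda>s r. \<Sum>t\<in>F. c t * lreg G t s r)) < \<epsilon>" if "\<epsilon> > 0" for \<epsilon>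
    using F(1,2) that by (intro exI[of _ F] exI[of _ c]) simp
  ultimately show "x \<in> reduced_cstar G"
    unfolding reduced_cstar_def by (simp add: F(3))
qed

lemma lreg_in_reduced: "t \<in> carrier G \<Longrightarrow> lreg G t \<in> reduced_cstar G"
  using lreg_in_span lreg_span_reduced by blast

text \<open>The matrix is a column of unitaries \<open>lreg G (g i)\<close> times its adjoint. After
  translation its form at \<open>\<eta>\<close> becomes the sum over y of |sum_i
  \<open>\<zeta> i y\<close>|^2, which gives reality and positivity together.\<close>

lemma pos_opmatrix_lreg:
  assumes g: "\<And>i. i < n \<Longrightarrow> g i \<in> carrier G"
  shows "pos_opmatrix G n (\<lambda>i j. lreg G (g i \<otimes> inv (g j)))"
  unfolding pos_opmatrix_def Let_def
proof (intro allI impI)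
  fix \<eta> :: "nat \<Rightarrow> 'a \<Rightarrow> complex"
  assume \<eta>: "\<forall>i<n. \<eta> i \<in> l2 G"
  \<comment> \<open>This is the adjoint of \<open>lreg G (g i)\<close> applied to
    \<open>\<eta> i\<close>.\<close>
  define \<zeta> where "\<zeta> i y = \<eta> i (g i \<otimes> y)" for i y
  have \<zeta>: "(\<lambda>x. (cmod (\<zeta> i x))\<^sup>2) summable_on carrier G" if "i < n" for i
    using summable_on_reindex_bij_betw[OF bij_betw_left_mult[OF g[OF that]], of "\<lambda>x. (cmod (\<eta> i x))\<^sup>2"]
      l2_summable[of "\<eta> i" G] \<eta> that by (simp add: \<zeta>_def)
  let ?z = "\<lambda>i j. l2inner G (kapply G (lreg G (g i \<otimes> inv (g j))) (\<eta> j)) (\<eta> i)"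
  have z: "((\<lambda>y. \<zeta> j y * cnj (\<zeta> i y)) has_sum ?z i j) (carrier G)" if ij: "i < n" "j < n" for i j
  proof -
    have "(\<lambda>y. \<zeta> j y * cnj (\<zeta> i y)) summable_on carrier G"
      using \<zeta> ij by (intro l2_product_summable) simp_all
    moreover have "?z i j = (\<Sum>\<^sub>\<infinity>y\<in>carrier G. \<zeta> j y * cnj (\<zeta> i y))"
    proof -
      have "?z i j = (\<Sum>\<^sub>\<infinity>x\<in>carrier G. \<eta> j (inv (g i \<otimes> inv (g j)) \<otimes> x) * cnj (\<eta> i x))"
        unfolding l2inner_def using g ij by (intro infsum_cong) (simp add: kapply_lreg)
      also have "\<dots> = (\<Sum>\<^sub>\<infinity>y\<in>carrier G. \<eta> j (inv (g i \<otimes> inv (g j)) \<otimes> (g i \<otimes> y)) * cnj (\<eta> i (g i \<otimes> y)))"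
        by (rule infsum_reindex_bij_betw[OF bij_betw_left_mult[OF g[OF ij(1)]], symmetric])
      also have "\<dots> = (\<Sum>\<^sub>\<infinity>y\<in>carrier G. \<zeta> j y * cnj (\<zeta> i y))"
      proof (rule infsum_cong)
        fix y assume y: "y \<in> carrier G"
        have "inv (g i \<otimes> inv (g j)) \<otimes> (g i \<otimes> y) = g j \<otimes> (inv (g i) \<otimes> (g i \<otimes> y))"
          using g ij y by (simp add: inv_mult_group m_assoc)
        also have "inv (g i) \<otimes> (g i \<otimes> y) = y"
          using g ij y by (simp add: m_assoc[symmetric])
        finally show "\<eta> j (inv (g i \<otimes> inv (g j)) \<otimes> (g i \<otimes> y)) * cnj (\<eta> i (g i \<otimes> y)) = \<zeta> j y * cnj (\<zeta> i y)"
          by (simp add: \<zeta>_def)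
      qed
      finally show ?thesis .
    qed
    ultimately show ?thesis by simp
  qed
  have "((\<lambda>y. \<Sum>i<n. \<Sum>j<n. \<zeta> j y * cnj (\<zeta> i y)) has_sum (\<Sum>i<n. \<Sum>j<n. ?z i j)) (carrier G)"
    by (intro has_sum_finite_sum z) auto
  moreover have "(\<Sum>i<n. \<Sum>j<n. \<zeta> j y * cnj (\<zeta> i y)) = of_real ((cmod (\<Sum>i<n. \<zeta> i y))\<^sup>2)" for y
    by (simp add: complex_norm_square sum_product del: of_real_power) (subst sum.swap, rule refl)
  ultimately have *: "((\<lambda>y. of_real ((cmod (\<Sum>i<n. \<zeta> i y))\<^sup>2)) has_sum (\<Sum>i<n. \<Sum>j<n. ?z i j)) (carrier G)"
    by simp
  have "((\<lambda>y. (cmod (\<Sum>i<n. \<zeta> i y))\<^sup>2) has_sum Re (\<Sum>i<n. \<Sum>j<n. ?z i j)) (carrier G)"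
    using has_sum_Re[OF *] by (simp only: Re_complex_of_real)
  then have "0 \<le> Re (\<Sum>i<n. \<Sum>j<n. ?z i j)"
    by (rule has_sum_nonneg) simp
  moreover have "((\<lambda>y. 0) has_sum Im (\<Sum>i<n. \<Sum>j<n. ?z i j)) (carrier G)"
    using has_sum_Im[OF *] by (simp only: Im_complex_of_real)
  then have "Im (\<Sum>i<n. \<Sum>j<n. ?z i j) = 0"
    using has_sum_unique[OF _ has_sum_0[of "carrier G" "\<lambda>y. 0 :: real"]] by blast
  ultimately show "Im (\<Sum>i<n. \<Sum>j<n. ?z i j) = 0 \<and> 0 \<le> Re (\<Sum>i<n. \<Sum>j<n. ?z i j)"
    by blast
qed

end

section \<open>Kernels of completely positive maps\<close>

text \<open>The operator matrix is tested on the point masses \<open>c i\<close> at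
  \<open>s i\<close>. A different matrix position may thus be read off from each block.\<close>

lemma pos_opmatrix_entries:
  assumes X: "pos_opmatrix G n X" and s: "\<And>i. i < n \<Longrightarrow> s i \<in> carrier G"
  shows "Im (\<Sum>i<n. \<Sum>j<n. X i j (s i) (s j) * c j * cnj (c i)) = 0"
    "0 \<le> Re (\<Sum>i<n. \<Sum>j<n. X i j (s i) (s j) * c j * cnj (c i))"
proof -
  define \<eta> where "\<eta> i = (\<lambda>x. if x = s i then c i else 0)" for i
  have "\<forall>i<n. \<eta> i \<in> l2 G"
    using s by (auto simp: \<eta>_def intro!: l2_point_mass)
  moreover have "(\<Sum>i<n. \<Sum>j<n. l2inner G (kapply G (X i j) (\<eta> j)) (\<eta> i))
      = (\<Sum>i<n. \<Sum>j<n. X i j (s i) (s j) * c j * cnj (c i))"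
    using s by (intro sum.cong refl) (simp add: \<eta>_def l2inner_point_mass kapply_point_mass)
  ultimately show "Im (\<Sum>i<n. \<Sum>j<n. X i j (s i) (s j) * c j * cnj (c i)) = 0"
    "0 \<le> Re (\<Sum>i<n. \<Sum>j<n. X i j (s i) (s j) * c j * cnj (c i))"
    using X[unfolded pos_opmatrix_def Let_def, THEN spec[of _ \<eta>]] by simp_all
qed

text \<open>Beyond the width of a finite width approximant \<open>w\<close>, the entry of
  \<open>y\<close> is the entry of \<open>y - w\<close>, which is bounded by the norm of that
  difference.\<close>

lemma uniform_roe_decay:
  assumes y: "y \<in> uniform_roe G S" and "\<epsilon> > 0"
  shows "\<exists>R. \<forall>s\<in>carrier G. \<forall>t\<in>carrier G. R \<le> word_dist G S s t \<longrightarrow> cmod (y s t) \<le> \<epsilon>"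
proof -
  from assms obtain w where w: "finite_width G S w" "bounded_op G w" "opnorm G (kdiff y w) < \<epsilon>"
    and y: "bounded_op G y"
    unfolding uniform_roe_def by blast
  from w(1) obtain R where R: "\<forall>s\<in>carrier G. \<forall>t\<in>carrier G. real (word_dist G S s t) > R \<longrightarrow> w s t = 0"
    unfolding finite_width_def by blast
  have "cmod (y s t) \<le> \<epsilon>"
    \<comment> \<open>The added 1 makes the distance strictly larger than \<open>R\<close>, as
      finite width requires.\<close>
    if st: "s \<in> carrier G" "t \<in> carrier G" and d: "nat \<lceil>R\<rceil> + 1 \<le> word_dist G S s t" for s t
  proof -
    have "w s t = 0" using d by (intro R[rule_format] st) linarith
    then show ?thesis
      using kernel_entry_le_opnorm[OF bounded_op_kdiff[OF y w(2)] st] w(3) by (simp add: kdiff_def)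
  qed
  then show ?thesis by blast
qed

lemma directed_order_finite_bound:
  fixes B :: "'x set"
  assumes "directed_order leq" "finite B"
  shows "\<exists>k. \<forall>x\<in>B. leq (f x) k"
  using assms(2)
proof (induction B rule: finite_induct)
  case (insert x B)
  then obtain k where "\<forall>x\<in>B. leq (f x) k" by blast
  moreover obtain k' where "leq k k'" "leq (f x) k'"
    using assms(1) unfolding directed_order_def by blast
  ultimately show ?case
    using assms(1) unfolding directed_order_def by (intro exI[of _ k']) blast
qed simp

section \<open>Words in the generators and finiteness of balls\<close>

context group
begin

lemma foldr_append_mult:
  "set xs \<subseteq> carrier G \<Longrightarrow> set ys \<subseteq> carrier G \<Longrightarrow>
   foldr (\<otimes>) (xs @ ys) \<one> = foldr (\<otimes>) xs \<one> \<otimes> foldr (\<otimes>) ys \<one> \<and> foldr (\<otimes>) xs \<one> \<in> carrier G"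
proof (induction xs)
  case Nil
  have "foldr (\<otimes>) ys \<one> \<in> carrier G"
    using Nil(2) by (induction ys) auto
  then show ?case by simp
next
  case (Cons x xs)
  moreover have "foldr (\<otimes>) ys \<one> \<in> carrier G"
    using Cons.prems(2) by (induction ys) auto
  ultimately show ?case by (simp add: m_assoc)
qed

lemma generate_as_word:
  assumes S: "S \<subseteq> carrier G" "\<forall>s\<in>S. inv s \<in> S" and g: "g \<in> generate G S"
  shows "\<exists>xs. set xs \<subseteq> S \<and> foldr (\<otimes>) xs \<one> = g"
  using g
proof (induction rule: generate.induct)
  case one
  show ?case by (intro exI[of _ "[]"]) simp
next
  case (incl h)
  then show ?case using S(1) by (intro exI[of _ "[h]"]) auto
next
  case (inv h)
  then show ?case using S by (intro exI[of _ "[inv h]"]) auto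
next
  case (eng h1 h2)
  then obtain xs ys where "set xs \<subseteq> S" "foldr (\<otimes>) xs \<one> = h1" "set ys \<subseteq> S" "foldr (\<otimes>) ys \<one> = h2"
    by blast
  then show ?case
    using foldr_append_mult[of xs ys] S(1) by (intro exI[of _ "xs @ ys"]) auto
qed

lemma countable_generate:
  assumes "finite S" "S \<subseteq> carrier G" "\<forall>s\<in>S. inv s \<in> S" "generate G S = carrier G"
  shows "countable (carrier G)"
proof (rule countable_subset)
  show "carrier G \<subseteq> (\<lambda>xs. foldr (\<otimes>) xs \<one>) ` lists S"
    using generate_as_word[OF assms(2,3)] assms(4) by (auto simp: image_iff in_lists_conv_set)
  show "countable ((\<lambda>xs. foldr (\<otimes>) xs \<one>) ` lists S)"
    using assms(1) by (intro countable_image countable_lists countable_finite)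
qed

lemma finite_word_ball:
  assumes "finite S" "S \<subseteq> carrier G" "\<forall>s\<in>S. inv s \<in> S" "generate G S = carrier G"
  shows "finite {g \<in> carrier G. word_length G S g \<le> n}"
proof (rule finite_subset)
  show "finite ((\<lambda>xs. foldr (\<otimes>) xs \<one>) ` {xs. set xs \<subseteq> S \<and> length xs \<le> n})"
    using assms(1) by (intro finite_imageI finite_lists_length_le)
  show "{g \<in> carrier G. word_length G S g \<le> n} \<subseteq> (\<lambda>xs. foldr (\<otimes>) xs \<one>) ` {xs. set xs \<subseteq> S \<and> length xs \<le> n}"
  proof
    fix g assume "g \<in> {g \<in> carrier G. word_length G S g \<le> n}"
    then have g: "g \<in> generate G S" "word_length G S g \<le> n" using assms(4) by auto
    \<comment> \<open>\<open>word_length\<close> is a \<open>LEAST\<close>, meaningful only when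
      some word represents \<open>g\<close>; generation by \<open>S\<close> supplies one, so the
      minimum is attained.\<close>
    then have "\<exists>m xs. length xs = m \<and> set xs \<subseteq> S \<and> foldr (\<otimes>) xs \<one> = g"
      using generate_as_word[OF assms(2,3)] by blast
    then have "\<exists>xs. length xs = word_length G S g \<and> set xs \<subseteq> S \<and> foldr (\<otimes>) xs \<one> = g"
      unfolding word_length_def by (rule LeastI_ex)
    then show "g \<in> (\<lambda>xs. foldr (\<otimes>) xs \<one>) ` {xs. set xs \<subseteq> S \<and> length xs \<le> n}"
      using g(2) by (auto simp: image_iff)
  qed
qed

section \<open>The kernel attached to one finite rank unital completely positive map\<close>

context
  fixes S :: "'a set" and T :: "'a kernel \<Rightarrow> 'a kernel"
  assumes T: "fr_ucp_map G S T"
begin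

lemma ucp_bounded_op: "x \<in> reduced_cstar G \<Longrightarrow> bounded_op G (T x)"
  using T unfolding fr_ucp_map_def uniform_roe_def by blast

text \<open>The points \<open>s i\<close> are kept independent of the group elements
  \<open>g i\<close>: the kernel takes them equal, while the bound on arbitrary entries of
  \<open>T (lreg G g)\<close> needs them different.\<close>

lemma ucp_lreg_positive:
  fixes n :: nat
  assumes g: "\<And>i. i < n \<Longrightarrow> g i \<in> carrier G" and s: "\<And>i. i < n \<Longrightarrow> s i \<in> carrier G"
  shows "Im (\<Sum>i<n. \<Sum>j<n. T (lreg G (g i \<otimes> inv (g j))) (s i) (s j) * c j * cnj (c i)) = 0"
    "0 \<le> Re (\<Sum>i<n. \<Sum>j<n. T (lreg G (g i \<otimes> inv (g j))) (s i) (s j) * c j * cnj (c i))"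
proof -
  have "\<forall>i<n. \<forall>j<n. lreg G (g i \<otimes> inv (g j)) \<in> reduced_cstar G"
    using g by (auto intro!: lreg_in_reduced)
  moreover have "completely_positive_on G (reduced_cstar G) T"
    using T by (simp add: fr_ucp_map_def)
  ultimately have pos: "pos_opmatrix G n (\<lambda>i j. T (lreg G (g i \<otimes> inv (g j))))"
    using pos_opmatrix_lreg[of n g, OF g] by (simp add: completely_positive_on_def)
  show "Im (\<Sum>i<n. \<Sum>j<n. T (lreg G (g i \<otimes> inv (g j))) (s i) (s j) * c j * cnj (c i)) = 0"
    "0 \<le> Re (\<Sum>i<n. \<Sum>j<n. T (lreg G (g i \<otimes> inv (g j))) (s i) (s j) * c j * cnj (c i))"
    by (rule pos_opmatrix_entries[OF pos s], assumption)+
qed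

lemma ucp_lreg_diagonal:
  assumes "s \<in> carrier G"
  shows "T (lreg G \<one>) s s = 1"
  using T assms unfolding fr_ucp_map_def by (simp add: lreg_def)

text \<open>For the group elements \<open>g\<close> and \<open>\<one>\<close> at the points
  \<open>s\<close> and \<open>t\<close>, positivity says that the 2 by 2 matrix with diagonal 1 and
  off-diagonal entries \<open>a\<close>, \<open>b\<close> is positive. Hence it is Hermitian with
  nonnegative determinant.\<close>

lemma ucp_lreg_entry:
  assumes g: "g \<in> carrier G" and st: "s \<in> carrier G" "t \<in> carrier G"
  shows "T (lreg G (inv g)) t s = cnj (T (lreg G g) s t)" "cmod (T (lreg G g) s t) \<le> 1"
proof -
  define a where "a = T (lreg G g) s t"
  define b where "b = T (lreg G (inv g)) t s"
  have *: "Im (c0 * cnj c0 + a * c1 * cnj c0 + (b * c0 * cnj c1 + c1 * cnj c1)) = 0"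
    "0 \<le> Re (c0 * cnj c0 + a * c1 * cnj c0 + (b * c0 * cnj c1 + c1 * cnj c1))" for c0 c1
    using ucp_lreg_positive[of 2 "\<lambda>i. if i = 0 then g else \<one>" "\<lambda>i. if i = 0 then s else t" "\<lambda>i. if i = 0 then c0 else c1"]
      g st ucp_lreg_diagonal by (simp_all add: numeral_2_eq_2 a_def b_def)
  \<comment> \<open>The vectors (1, 1) and (1, i) give Im (a + b) = 0 and Re (a - b) = 0.\<close>
  have b: "b = cnj a"
    using *(1)[of 1 1] *(1)[of 1 \<i>] by (simp add: complex_eq_iff)
  \<comment> \<open>The vector (-a, 1) evaluates the form to the determinant.\<close>
  have "0 \<le> Re (1 - a * cnj a)"
    using *(2)[of "- a" 1] by (simp add: b mult.commute)
  then have "(cmod a)\<^sup>2 \<le> 1"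
    by (simp add: complex_mult_cnj cmod_power2)
  then show "cmod (T (lreg G g) s t) \<le> 1"
    unfolding a_def[symmetric] using abs_square_le_1[of "cmod a"] by simp
  show "T (lreg G (inv g)) t s = cnj (T (lreg G g) s t)"
    using b by (simp add: a_def b_def)
qed

text \<open>Positive definite because \<open>lreg G (s \<otimes> inv t) = lreg G s (lreg G t)\<^sup>*\<close> and \<open>T\<close> is completely positive.\<close>

definition ucp_kernel :: "'a \<Rightarrow> 'a \<Rightarrow> real" where
  "ucp_kernel s t = Re (T (lreg G (s \<otimes> inv t)) s t)"

lemma ucp_kernel_diag: "s \<in> carrier G \<Longrightarrow> ucp_kernel s s = 1"
  by (simp add: ucp_kernel_def ucp_lreg_diagonal)

lemma ucp_kernel_pd: "pd_kernel (carrier G) ucp_kernel"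
  unfolding pd_kernel_def
proof (intro conjI ballI allI impI)
  fix s t assume st: "s \<in> carrier G" "t \<in> carrier G"
  have "inv (s \<otimes> inv t) = t \<otimes> inv s"
    using st by (simp add: inv_mult_group)
  then show "ucp_kernel s t = ucp_kernel t s"
    using ucp_lreg_entry(1)[of "s \<otimes> inv t" s t] st by (simp add: ucp_kernel_def)
next
  fix n and g :: "nat \<Rightarrow> 'a" and c :: "nat \<Rightarrow> real"
  assume "\<forall>i<n. g i \<in> carrier G"
  then have "0 \<le> Re (\<Sum>i<n. \<Sum>j<n. T (lreg G (g i \<otimes> inv (g j))) (g i) (g j) * of_real (c j) * cnj (of_real (c i)))"
    by (intro ucp_lreg_positive) auto
  also have "\<dots> = (\<Sum>i<n. \<Sum>j<n. c i * c j * ucp_kernel (g i) (g j))"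
    by (simp add: ucp_kernel_def mult_ac)
  finally show "0 \<le> (\<Sum>i<n. \<Sum>j<n. c i * c j * ucp_kernel (g i) (g j))" .
qed

text \<open>The operator \<open>lreg G (s \<otimes> inv t)\<close> has entry 1 at position (s, t),
  so \<open>1 - ucp_kernel s t\<close> is, up to sign, the real part of an entry of the difference.
  The bound depends on (s, t) only through \<open>s \<otimes> inv t\<close>.\<close>

lemma ucp_kernel_close:
  assumes st: "s \<in> carrier G" "t \<in> carrier G"
  shows "\<bar>1 - ucp_kernel s t\<bar> \<le> opnorm G (kdiff (T (lreg G (s \<otimes> inv t))) (lreg G (s \<otimes> inv t)))"
proof -
  let ?g = "s \<otimes> inv t"
  have g: "?g \<in> carrier G" using st by simp
  have "cmod (kdiff (T (lreg G ?g)) (lreg G ?g) s t) \<le> opnorm G (kdiff (T (lreg G ?g)) (lreg G ?g))"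
    using st g by (intro kernel_entry_le_opnorm bounded_op_kdiff bounded_op_lreg ucp_bounded_op lreg_in_reduced)
  moreover have "lreg G ?g s t = 1"
    using st by (simp add: lreg_def m_assoc)
  moreover have "\<bar>Re (T (lreg G ?g) s t - 1)\<bar> \<le> cmod (T (lreg G ?g) s t - 1)"
    by (rule abs_Re_le_cmod)
  ultimately show ?thesis
    by (simp add: kdiff_def ucp_kernel_def abs_minus_commute)
qed

text \<open>Point evaluations serve as coordinate functionals on the range of the finite rank map
  \<open>T\<close>, so positivity bounds the coordinates of \<open>T (lreg G g)\<close> uniformly in \<open>g\<close>.\<close>

lemma ucp_kernel_decay:
  assumes "\<epsilon> > 0"
  shows "\<exists>R. \<forall>s\<in>carrier G. \<forall>t\<in>carrier G. R \<le> word_dist G S s t \<longrightarrow> ucp_kernel s t \<le> \<epsilon>"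
proof -
  obtain F where F: "finite F" "\<forall>x\<in>reduced_cstar G. \<exists>c. T x = (\<lambda>s r. \<Sum>f\<in>F. c f * f s r)"
    using T unfolding fr_ucp_map_def finite_rank_on_def by blast
  \<comment> \<open>Operators are read as functions on pairs, so the evaluation points are matrix
    positions.\<close>
  define V where "V = (\<lambda>x. case_prod (T x)) ` lreg_span"
  have inj: "inj_on case_prod F"
    by (metis curry_case_prod inj_onI)
  have "\<exists>P h. finite P \<and> (\<forall>p\<in>P. h p \<in> V) \<and> (\<forall>p\<in>P. \<forall>q\<in>P. h p q = (if p = q then 1 else 0)) \<and>
    (\<forall>v\<in>V. \<forall>x. v x = (\<Sum>p\<in>P. v p * h p x))"
  proof (rule linear_subspace_dual_points)
    show "finite (case_prod ` F)" using F(1) by simp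
  next
    fix v w a b assume "v \<in> V" "w \<in> V"
    then obtain x y where xy: "x \<in> lreg_span" "y \<in> lreg_span" "v = case_prod (T x)" "w = case_prod (T y)"
      unfolding V_def by blast
    then have "T (\<lambda>s r. a * x s r + b * y s r) = (\<lambda>s r. a * T x s r + b * T y s r)"
      using T lreg_span_reduced unfolding fr_ucp_map_def linear_on_def by blast
    then have "(\<lambda>p. a * v p + b * w p) = case_prod (T (\<lambda>s r. a * x s r + b * y s r))"
      by (simp add: xy fun_eq_iff)
    then show "(\<lambda>p. a * v p + b * w p) \<in> V"
      unfolding V_def using lreg_span_combination[OF xy(1,2)] by blast
  next
    fix v assume "v \<in> V"
    then obtain x where x: "x \<in> reduced_cstar G" "v = case_prod (T x)"
      unfolding V_def using lreg_span_reduced by blast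
    then obtain c where c: "T x = (\<lambda>s r. \<Sum>f\<in>F. c f * f s r)"
      using F(2) by blast
    have "v = (\<lambda>p. \<Sum>f\<in>case_prod ` F. c (curry f) * f p)"
      unfolding sum.reindex[OF inj] by (simp add: x(2) c fun_eq_iff)
    then show "\<exists>c. v = (\<lambda>p. \<Sum>f\<in>case_prod ` F. c f * f p)"
      by (rule exI[of _ "\<lambda>f. c (curry f)"])
  qed
  then obtain P h where P: "finite P" and h: "\<forall>p\<in>P. h p \<in> V"
    and rep: "\<forall>v\<in>V. \<forall>x. v x = (\<Sum>p\<in>P. v p * h p x)"
    by (elim exE conjE) (rule that)
  \<comment> \<open>An equal share for each basis function; the added 1 covers empty
    \<open>P\<close>.\<close>
  define \<epsilon>' where "\<epsilon>' = \<epsilon> / (real (card P) + 1)"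
  have \<epsilon>': "\<epsilon>' > 0" "real (card P) * \<epsilon>' \<le> \<epsilon>"
    using assms by (simp_all add: \<epsilon>'_def field_simps)
  \<comment> \<open>Finite rank places no condition on the spanning set \<open>F\<close>, but the
    dual basis lies in \<open>V\<close>: each \<open>h p\<close> is a value of \<open>T\<close>,
    hence in the Roe algebra, and its entries decay.\<close>
  have "\<exists>R. \<forall>s\<in>carrier G. \<forall>t\<in>carrier G. R \<le> word_dist G S s t \<longrightarrow> cmod (h p (s, t)) \<le> \<epsilon>'" if "p \<in> P" for p
  proof -
    have "h p \<in> V" using h that by blast
    then obtain x where x: "h p = case_prod (T x)" "x \<in> lreg_span"
      unfolding V_def by (rule imageE)
    then have "T x \<in> uniform_roe G S"
      using T lreg_span_reduced unfolding fr_ucp_map_def by blast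
    from uniform_roe_decay[OF this \<epsilon>'(1)] show ?thesis by (simp add: x(1))
  qed
  then have "\<forall>p\<in>P. \<exists>R. \<forall>s\<in>carrier G. \<forall>t\<in>carrier G.
      R \<le> word_dist G S s t \<longrightarrow> cmod (h p (s, t)) \<le> \<epsilon>'"
    by blast
  then obtain R where R: "\<forall>p\<in>P. \<forall>s\<in>carrier G. \<forall>t\<in>carrier G.
      R p \<le> word_dist G S s t \<longrightarrow> cmod (h p (s, t)) \<le> \<epsilon>'"
    by (rule bchoice[THEN exE])
  have "ucp_kernel s t \<le> \<epsilon>"
    if st: "s \<in> carrier G" "t \<in> carrier G" and d: "(\<Sum>p\<in>P. R p) \<le> word_dist G S s t" for s t
  proof -
    let ?v = "case_prod (T (lreg G (s \<otimes> inv t)))"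
    have g: "s \<otimes> inv t \<in> carrier G" using st by simp
    have v1: "cmod (?v p) \<le> 1" for p
    proof (cases p)
      case (Pair x y)
      show ?thesis
      proof (cases "x \<in> carrier G \<and> y \<in> carrier G")
        case True
        then show ?thesis using ucp_lreg_entry(2)[OF g] Pair by simp
      next
        case False
        then show ?thesis
          using bounded_op_zero[OF ucp_bounded_op[OF lreg_in_reduced[OF g]], of x y] Pair by auto
      qed
    qed
    have "?v \<in> V" unfolding V_def using lreg_in_span[OF g] by blast
    then have "?v (s, t) = (\<Sum>p\<in>P. ?v p * h p (s, t))"
      by (rule rep[rule_format])
    then have "cmod (?v (s, t)) \<le> (\<Sum>p\<in>P. cmod (?v p) * cmod (h p (s, t)))"
      by (simp only: norm_mult[symmetric] norm_sum)
    also have "\<dots> \<le> (\<Sum>p\<in>P. 1 * \<epsilon>')"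
    proof (intro sum_mono mult_mono v1)
      fix p assume p: "p \<in> P"
      have "R p \<le> word_dist G S s t"
        using member_le_sum[of p P R] P p d by simp
      then show "cmod (h p (s, t)) \<le> \<epsilon>'" using R p st by blast
    qed simp_all
    also have "\<dots> \<le> \<epsilon>" using \<epsilon>'(2) by simp
    finally have "cmod (T (lreg G (s \<otimes> inv t)) s t) \<le> \<epsilon>" by simp
    then show ?thesis
      unfolding ucp_kernel_def by (rule order_trans[OF complex_Re_le_cmod])
  qed
  then show ?thesis by blast
qed

end

end

theorem theorem3p1:
  fixes G :: "('a, 'b) monoid_scheme" and S :: "'a set"
    and leq :: "'i \<Rightarrow> 'i \<Rightarrow> bool" and T :: "'i \<Rightarrow> 'a kernel \<Rightarrow> 'a kernel"
  assumes "group G"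
    and "finite S" and "S \<subseteq> carrier G" and "\<forall>s\<in>S. inv\<^bsub>G\<^esub> s \<in> S"
    and "generate G S = carrier G"
    and "directed_order leq"
    and "\<forall>i. fr_ucp_map G S (T i)"
    and "\<forall>x\<in>reduced_cstar G. \<forall>\<epsilon>>0. \<exists>i0. \<forall>i. leq i0 i \<longrightarrow> opnorm G (kdiff (T i x) x) < \<epsilon>"
  shows "uniformly_embeddable G S"
proof -
  interpret group G by fact
  note gen = assms(2-5)
  have T: "fr_ucp_map G S (T i)" for i using assms(7) by blast
  \<comment> \<open>The net converges only pointwise, but the ball of radius \<open>n\<close> is
    finite, so directedness yields one index that serves the whole ball.\<close>
  have "\<exists>i. \<forall>g\<in>carrier G. word_length G S g \<le> n \<longrightarrow> opnorm G (kdiff (T i (lreg G g)) (lreg G g)) \<le> (1/2) ^ n" for n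
  proof -
    let ?B = "{g \<in> carrier G. word_length G S g \<le> n}"
    have "\<exists>i0. \<forall>i. leq i0 i \<longrightarrow> opnorm G (kdiff (T i (lreg G g)) (lreg G g)) < (1/2) ^ n" if "g \<in> ?B" for g
      using assms(8) lreg_in_reduced that by simp
    then obtain f where f: "\<And>g i. g \<in> ?B \<Longrightarrow> leq (f g) i \<Longrightarrow>
        opnorm G (kdiff (T i (lreg G g)) (lreg G g)) < (1/2) ^ n"
      by metis
    obtain k where "\<forall>g\<in>?B. leq (f g) k"
      using directed_order_finite_bound[OF assms(6) finite_word_ball[OF gen]] by blast
    then show ?thesis
      using f by (intro exI[of _ k]) (auto intro: less_imp_le)
  qed
  then obtain i where i: "\<And>n g. g \<in> carrier G \<Longrightarrow> word_length G S g \<le> n \<Longrightarrow>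
      opnorm G (kdiff (T (i n) (lreg G g)) (lreg G g)) \<le> (1/2) ^ n"
    by metis
  show ?thesis
    unfolding uniformly_embeddable_def
  proof (rule pd_kernels_uniform_embedding)
    show "countable (carrier G)" by (rule countable_generate[OF gen])
    show "carrier G \<noteq> {}" by blast
    show "pd_kernel (carrier G) (ucp_kernel (T (i n)))" for n by (rule ucp_kernel_pd[OF T])
    show "ucp_kernel (T (i n)) x x = 1" if "x \<in> carrier G" for n x
      by (rule ucp_kernel_diag[OF T that])
    show "\<bar>1 - ucp_kernel (T (i n)) x y\<bar> \<le> (1/2) ^ n"
      if "x \<in> carrier G" "y \<in> carrier G" "word_dist G S x y \<le> n" for n x y
      using ucp_kernel_close[OF T that(1,2)] i[of "x \<otimes>\<^bsub>G\<^esub> inv\<^bsub>G\<^esub> y" n] that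
      unfolding word_dist_def by (meson inv_closed m_closed order_trans)
    show "\<exists>R. \<forall>x\<in>carrier G. \<forall>y\<in>carrier G. R \<le> word_dist G S x y \<longrightarrow> ucp_kernel (T (i n)) x y \<le> 1/2" for n
      by (rule ucp_kernel_decay[OF T]) simp
  qed
qed

end
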